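(* There exist $2^{\aleph_1}$ pairwise non-diffeomorphic differential structures on $\mathbb L_+^2$ each of which is a product structure, i.e. of the form $(\mathbb L_+,\mathcal D)\times(\mathbb L_+,\mathcal E)$ for differential structures $\mathcal D,\mathcal E$ on $\mathbb L_+$.
   Context: $\omega_1$ denotes the set of countable ordinals. The closed long ray $\mathbb L_{\ge0}$ is $\omega_1\times[0,1)$ with the lexicographic order topology, and the long ray is $\mathbb L_+=\mathbb L_{\ge0}\setminus\{(0,0)\}$. A "differential structure" means a $C^r$ differential structure for some $r\ge1$. *)

theory Defs
  imports "HOL-Analysis.Analysis" "HOL-Library.Extended_Nat"
begin

text \<open>omega1 is the successor cardinal of aleph_0, i.e. a well-order of order type
  the first uncountable ordinal (an initial ordinal), on the carrier Field omega1.\<close>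
definition omega1 :: "nat set rel" where
  "omega1 = cardSuc natLeq"

definition omega1_zero :: "nat set" where
  "omega1_zero = (SOME a. a \<in> Field omega1 \<and> (\<forall>b\<in>Field omega1. (a, b) \<in> omega1))"

type_synonym lpt = "nat set \<times> real"

definition lex_less :: "lpt \<Rightarrow> lpt \<Rightarrow> bool" where
  "lex_less p q \<longleftrightarrow>
     ((fst p, fst q) \<in> omega1 \<and> fst p \<noteq> fst q) \<or> (fst p = fst q \<and> snd p < snd q)"

definition Lgeq_set :: "lpt set" where
  "Lgeq_set = Field omega1 \<times> {0..<1}"

definition Lgeq :: "lpt topology" where
  "Lgeq = topology_generated_by
     ((\<lambda>p. {q \<in> Lgeq_set. lex_less q p}) ` Lgeq_set \<union>
      (\<lambda>p. {q \<in> Lgeq_set. lex_less p q}) ` Lgeq_set)"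

definition Lplus :: "lpt topology" where
  "Lplus = subtopology Lgeq (Lgeq_set - {(omega1_zero, 0)})"

definition Lplus2 :: "(lpt \<times> lpt) topology" where
  "Lplus2 = prod_topology Lplus Lplus"

fun Ck :: "nat \<Rightarrow> 'a::euclidean_space set \<Rightarrow> ('a \<Rightarrow> 'b::real_normed_vector) \<Rightarrow> bool" where
  "Ck 0 U f = continuous_on U f"
| "Ck (Suc k) U f =
     ((\<forall>x\<in>U. f differentiable (at x)) \<and>
      (\<forall>v\<in>Basis. Ck k U (\<lambda>x. frechet_derivative f (at x) v)))"

definition Cr :: "enat \<Rightarrow> 'a::euclidean_space set \<Rightarrow> ('a \<Rightarrow> 'b::real_normed_vector) \<Rightarrow> bool" where
  "Cr r U f \<longleftrightarrow> (\<forall>k. enat k \<le> r \<longrightarrow> Ck k U f)"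

definition is_chart :: "'x topology \<Rightarrow> ('x set \<times> ('x \<Rightarrow> 'e::euclidean_space)) \<Rightarrow> bool" where
  "is_chart X c \<longleftrightarrow> (case c of (U, \<phi>) \<Rightarrow>
     openin X U \<and> open (\<phi> ` U) \<and>
     homeomorphic_map (subtopology X U) (top_of_set (\<phi> ` U)) \<phi>)"

definition compatible :: "enat \<Rightarrow> ('x set \<times> ('x \<Rightarrow> 'e::euclidean_space))
     \<Rightarrow> ('x set \<times> ('x \<Rightarrow> 'e)) \<Rightarrow> bool" where
  "compatible r c d \<longleftrightarrow> (case c of (U, \<phi>) \<Rightarrow> case d of (V, \<psi>) \<Rightarrow>
     Cr r (\<phi> ` (U \<inter> V)) (\<psi> \<circ> inv_into U \<phi>) \<and>
     Cr r (\<psi> ` (U \<inter> V)) (\<phi> \<circ> inv_into V \<psi>))"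

definition diff_structure :: "enat \<Rightarrow> 'x topology \<Rightarrow> ('x set \<times> ('x \<Rightarrow> 'e::euclidean_space)) set \<Rightarrow> bool" where
  "diff_structure r X A \<longleftrightarrow>
     (\<forall>c\<in>A. is_chart X c) \<and>
     \<Union>(fst ` A) = topspace X \<and>
     (\<forall>c\<in>A. \<forall>d\<in>A. compatible r c d) \<and>
     (\<forall>c. is_chart X c \<and> (\<forall>a\<in>A. compatible r a c) \<longrightarrow> c \<in> A)"

definition max_atlas :: "enat \<Rightarrow> 'x topology \<Rightarrow> ('x set \<times> ('x \<Rightarrow> 'e::euclidean_space)) set
    \<Rightarrow> ('x set \<times> ('x \<Rightarrow> 'e)) set" where
  "max_atlas r X A = {c. is_chart X c \<and> (\<forall>a\<in>A. compatible r a c)}"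

definition prod_charts :: "('x set \<times> ('x \<Rightarrow> 'e::euclidean_space)) set
    \<Rightarrow> ('y set \<times> ('y \<Rightarrow> 'f::euclidean_space)) set
    \<Rightarrow> (('x \<times> 'y) set \<times> ('x \<times> 'y \<Rightarrow> 'e \<times> 'f)) set" where
  "prod_charts D E = {(U \<times> V, \<lambda>(x, y). (\<phi> x, \<psi> y)) | U \<phi> V \<psi>. (U, \<phi>) \<in> D \<and> (V, \<psi>) \<in> E}"

definition product_structure :: "enat \<Rightarrow> 'x topology \<Rightarrow> ('x set \<times> ('x \<Rightarrow> 'e::euclidean_space)) set
    \<Rightarrow> 'y topology \<Rightarrow> ('y set \<times> ('y \<Rightarrow> 'f::euclidean_space)) set
    \<Rightarrow> (('x \<times> 'y) set \<times> ('x \<times> 'y \<Rightarrow> 'e \<times> 'f)) set" where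
  "product_structure r X D Y E = max_atlas r (prod_topology X Y) (prod_charts D E)"

definition smooth_map :: "enat \<Rightarrow> 'x topology \<Rightarrow> ('x set \<times> ('x \<Rightarrow> 'e::euclidean_space)) set
    \<Rightarrow> 'y topology \<Rightarrow> ('y set \<times> ('y \<Rightarrow> 'f::euclidean_space)) set \<Rightarrow> ('x \<Rightarrow> 'y) \<Rightarrow> bool" where
  "smooth_map r X A Y B f \<longleftrightarrow>
     continuous_map X Y f \<and>
     (\<forall>(U, \<phi>)\<in>A. \<forall>(V, \<psi>)\<in>B.
        Cr r (\<phi> ` (U \<inter> f -` V)) (\<psi> \<circ> f \<circ> inv_into U \<phi>))"

definition diffeomorphic :: "enat \<Rightarrow> 'x topology \<Rightarrow> ('x set \<times> ('x \<Rightarrow> 'e::euclidean_space)) set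
    \<Rightarrow> 'y topology \<Rightarrow> ('y set \<times> ('y \<Rightarrow> 'f::euclidean_space)) set \<Rightarrow> bool" where
  "diffeomorphic r X A Y B \<longleftrightarrow>
     (\<exists>f g. smooth_map r X A Y B f \<and> smooth_map r Y B X A g \<and>
        (\<forall>x\<in>topspace X. g (f x) = x) \<and> (\<forall>y\<in>topspace Y. f (g y) = y))"

end

theory Submission
  imports Defs "HOL-Library.Countable_Set_Type"
begin

text \<open>
  For every countable ordinal \<open>a\<close> a chart \<open>g\<^sub>a\<close> of the initial segment up to block \<open>a\<close> is built by recursion so that all
  transitions are smooth; at the corner \<open>(a, 0)\<close> the rate at which \<open>g\<^sub>a\<close> tends to \<open>0\<close> along a fixed cofinal
  sequence is \<open>n powr - e\<close>, where the exponent \<open>e\<close> can be prescribed for each \<open>a\<close> independently.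
  A diffeomorphism between two squares of such structures maps the squares \<open>(0, c) \<times> (0, c)\<close>, hence also their boundaries, to
  themselves for a closed unbounded set of \<open>c\<close>. At a boundary point \<open>(s, y)\<close> that is a limit of boundary points
  \<open>(c\<^sub>n, y)\<close> and is not mapped to the corner \<open>(s, s)\<close>, one coordinate of the image of \<open>(c\<^sub>n, y)\<close> is \<open>c\<^sub>n\<close>;
  differentiability there makes one rate linearly bounded by the other, and the inverse gives the opposite bound.
  So the two exponents agree at \<open>s\<close>. Taking the exponent at \<open>a\<close> to encode \<open>A \<inter> a\<close> for a set \<open>A\<close> of countable
  ordinals, distinct sets yield exponents that differ at all large \<open>a\<close>.
\<close>

section \<open>Functions of class $C^k$\<close>

text \<open>The set of invariant indices depends on the diffeomorphism, so nothing can be said about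
  a prescribed index; agreement of exponents is only known at some index above any given bound. This
  is why each exponent has to remember a whole initial segment of \<open>A\<close>, which a single
  real number can do because the segment is countable. The invariant corners that approach the
  corner at \<open>s\<close> need not belong to the fixed cofinal sequence either. Polynomial decay
  takes care of that: consecutive values \<open>n powr - e\<close> have bounded ratio, so a linear
  bound along one arbitrary sequence already compares the exponents. An edge of a square may be
  carried to either edge of the target square; with the same ray structure in both factors the
  outcome is independent of which one occurs. The comparison rests on differentiability at a single
  point, while the transitions are smooth of every order, so one construction serves all
  \<open>r \<ge> 1\<close>, infinity included.\<close>

lemma Ck_subset: "Ck k U f \<Longrightarrow> V \<subseteq> U \<Longrightarrow> Ck k V f"
  by (induction k arbitrary: f) (auto intro: continuous_on_subset)

lemma Ck_SucD: "Ck (Suc k) U f \<Longrightarrow> Ck k U f"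
  by (induction k arbitrary: f)
    (auto intro!: differentiable_imp_continuous_within continuous_at_imp_continuous_on)

lemma Ck_imp_continuous_on: "Ck k U f \<Longrightarrow> continuous_on U f"
  by (induction k) (auto dest: Ck_SucD simp del: Ck.simps(2))

text \<open>\<open>frechet_derivative f (at x)\<close> depends on all values of \<open>f\<close>
  near \<open>x\<close>; openness of \<open>U\<close> supplies such a neighbourhood at every stage
  of the induction.\<close>

lemma Ck_cong_open:
  assumes "open U" "\<And>x. x \<in> U \<Longrightarrow> f x = g x" "Ck k U f"
  shows "Ck k U g"
  using assms(2,3)
proof (induction k arbitrary: f g)
  case 0
  then show ?case by (metis Ck.simps(1) continuous_on_cong)
next
  case (Suc k)
  have der: "(g has_derivative frechet_derivative f (at x)) (at x)" if "x \<in> U" for x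
  proof -
    have "(f has_derivative frechet_derivative f (at x)) (at x)"
      using Suc.prems(2) that by (simp add: frechet_derivative_works)
    then show ?thesis
      using has_derivative_transform_within_open[OF _ assms(1) that] Suc.prems(1) by blast
  qed
  then have "frechet_derivative f (at x) = frechet_derivative g (at x)" if "x \<in> U" for x
    using that frechet_derivative_at by blast
  moreover have "\<And>x. x \<in> U \<Longrightarrow> g differentiable (at x)"
    using der differentiable_def by blast
  ultimately show ?case
    using Suc.prems(2) Suc.IH[of "\<lambda>x. frechet_derivative f (at x) v" "\<lambda>x. frechet_derivative g (at x) v" for v]
    by simp
qed

lemma Ck_local:
  assumes "\<And>x. x \<in> U \<Longrightarrow> \<exists>V. open V \<and> x \<in> V \<and> Ck k V f"
  shows "Ck k U f"
  using assms
proof (induction k arbitrary: f)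
  case 0
  then show ?case
    by (metis Ck.simps(1) continuous_at_imp_continuous_on continuous_on_eq_continuous_at)
next
  case (Suc k)
  show ?case
    unfolding Ck.simps
  proof (intro conjI ballI)
    show "f differentiable at x" if "x \<in> U" for x
      using Suc.prems[OF that] by auto
    show "Ck k U (\<lambda>x. frechet_derivative f (at x) v)" if "v \<in> Basis" for v
      using Suc.prems that by (intro Suc.IH) force
  qed
qed

lemma Ck_has_derivative:
  "Ck (Suc k) U f \<Longrightarrow> x \<in> U \<Longrightarrow> (f has_derivative frechet_derivative f (at x)) (at x)"
  using frechet_derivative_works by auto

text \<open>Lets an explicitly known derivative stand in for \<open>frechet_derivative\<close>,
  which is only given by choice.\<close>

lemma Ck_SucI:
  assumes "open U" and f': "\<And>x. x \<in> U \<Longrightarrow> (f has_derivative f' x) (at x)"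
    and "\<And>v. v \<in> Basis \<Longrightarrow> Ck k U (\<lambda>x. f' x v)"
  shows "Ck (Suc k) U f"
  unfolding Ck.simps
proof (intro conjI ballI)
  show "f differentiable at x" if "x \<in> U" for x
    using f'[OF that] differentiable_def by blast
  fix v :: 'a assume v: "v \<in> Basis"
  show "Ck k U (\<lambda>x. frechet_derivative f (at x) v)"
    by (rule Ck_cong_open[OF assms(1) _ assms(3)[OF v]]) (metis f' frechet_derivative_at)
qed

lemma Ck_const: "open U \<Longrightarrow> Ck k U (\<lambda>x. c)"
proof (induction k arbitrary: c)
  case (Suc k)
  show ?case
    by (rule Ck_SucI[OF Suc.prems has_derivative_const]) (use Suc in simp)
qed simp

lemma Ck_bounded_linear:
  assumes "open U" "bounded_linear L" "Ck k U f"
  shows "Ck k U (\<lambda>x. L (f x))"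
  using assms(3)
proof (induction k arbitrary: f)
  case 0
  then show ?case
    using assms(2) by (simp add: bounded_linear.continuous_on)
next
  case (Suc k)
  show ?case
    by (rule Ck_SucI[OF assms(1) bounded_linear.has_derivative[OF assms(2) Ck_has_derivative[OF Suc.prems]]])
      (use Suc in auto)
qed

lemma Ck_linear:
  assumes "open U" "bounded_linear L"
  shows "Ck k U L"
proof (cases k)
  case 0
  then show ?thesis using assms(2) by (simp add: linear_continuous_on)
next
  case (Suc k)
  show ?thesis unfolding Suc
    by (rule Ck_SucI[OF assms(1) bounded_linear_imp_has_derivative[OF assms(2)]])
      (rule Ck_const[OF assms(1)])
qed

lemma Ck_add:
  assumes "open U" "Ck k U f" "Ck k U g"
  shows "Ck k U (\<lambda>x. f x + g x)"
  using assms(2,3)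
proof (induction k arbitrary: f g)
  case 0
  then show ?case by (simp add: continuous_on_add)
next
  case (Suc k)
  show ?case
    by (rule Ck_SucI[OF assms(1) has_derivative_add[OF Ck_has_derivative[OF Suc.prems(1)] Ck_has_derivative[OF Suc.prems(2)]]])
      (use Suc in auto)
qed

lemma Ck_sum:
  assumes "open U" "\<And>i. i \<in> I \<Longrightarrow> Ck k U (f i)"
  shows "Ck k U (\<lambda>x. \<Sum>i\<in>I. f i x)"
  using assms(2) by (induction I rule: infinite_finite_induct) (auto intro: Ck_const Ck_add assms(1))

lemma Ck_scaleR:
  fixes f :: "'a::euclidean_space \<Rightarrow> real"
  assumes "open U" "Ck k U f" "Ck k U g"
  shows "Ck k U (\<lambda>x. f x *\<^sub>R g x)"
  using assms(2,3)
proof (induction k arbitrary: f g)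
  case 0
  then show ?case by (simp add: continuous_on_scaleR)
next
  case (Suc k)
  show ?case
    by (rule Ck_SucI[OF assms(1) has_derivative_scaleR[OF Ck_has_derivative[OF Suc.prems(1)] Ck_has_derivative[OF Suc.prems(2)]]])
      (use Suc Ck_SucD[OF Suc.prems(1)] Ck_SucD[OF Suc.prems(2)] in \<open>auto intro!: Ck_add assms(1)\<close>)
qed

lemma Ck_mult:
  fixes f g :: "'a::euclidean_space \<Rightarrow> real"
  assumes "open U" "Ck k U f" "Ck k U g"
  shows "Ck k U (\<lambda>x. f x * g x)"
  using Ck_scaleR[OF assms] by simp

text \<open>\<open>Ck\<close> only controls derivatives in the directions of \<open>Basis\<close>,
  but the chain rule evaluates the derivative of \<open>g\<close> in the moving direction
  \<open>?f' x v\<close>. Expanding that direction in coordinates turns the derivative of the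
  composite into a finite sum of products of functions of class \<open>C^k\<close>.\<close>

lemma Ck_compose:
  fixes f :: "'a::euclidean_space \<Rightarrow> 'b::euclidean_space" and g :: "'b \<Rightarrow> 'c::real_normed_vector"
  assumes "open U" "f ` U \<subseteq> V" "Ck k V g" "Ck k U f"
  shows "Ck k U (\<lambda>x. g (f x))"
  using assms(3,4)
proof (induction k arbitrary: g)
  case 0
  then show ?case using assms(2) by (simp add: continuous_on_compose2)
next
  case (Suc k)
  let ?g' = "\<lambda>y. frechet_derivative g (at y)" and ?f' = "\<lambda>x. frechet_derivative f (at x)"
  show ?case
  proof (rule Ck_SucI[OF assms(1)])
    fix x assume x: "x \<in> U"
    then have fx: "f x \<in> V" using assms(2) by blast
    have "((\<lambda>x. g (f x)) has_derivative (\<lambda>v. ?g' (f x) (?f' x v))) (at x)"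
      by (rule has_derivative_compose[OF Ck_has_derivative[OF Suc.prems(2) x]
            Ck_has_derivative[OF Suc.prems(1) fx]])
    moreover have "?g' (f x) w = (\<Sum>b\<in>Basis. (w \<bullet> b) *\<^sub>R ?g' (f x) b)" (is "_ = ?s w") for w
    proof -
      have lin: "linear (?g' (f x))"
        using Ck_has_derivative[OF Suc.prems(1) fx] has_derivative_linear by blast
      have "?g' (f x) w = ?g' (f x) (\<Sum>b\<in>Basis. (w \<bullet> b) *\<^sub>R b)"
        by (simp add: euclidean_representation)
      also have "\<dots> = (\<Sum>b\<in>Basis. (w \<bullet> b) *\<^sub>R ?g' (f x) b)"
        by (simp add: linear_sum[OF lin] linear_scale[OF lin])
      finally show ?thesis .
    qed
    ultimately show "((\<lambda>x. g (f x)) has_derivative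
        (\<lambda>v. \<Sum>b\<in>Basis. (?f' x v \<bullet> b) *\<^sub>R ?g' (f x) b)) (at x)"
      by (rule has_derivative_eq_rhs[OF _ ext])
  next
    fix v :: 'a assume v: "v \<in> Basis"
    show "Ck k U (\<lambda>x. \<Sum>b\<in>Basis. (?f' x v \<bullet> b) *\<^sub>R ?g' (f x) b)"
    proof (intro Ck_sum Ck_scaleR assms(1))
      fix b :: 'b assume b: "b \<in> Basis"
      show "Ck k U (\<lambda>x. ?f' x v \<bullet> b)"
        using Suc.prems(2) v
        by (intro Ck_bounded_linear[OF assms(1) bounded_linear_inner_left]) simp
      show "Ck k U (\<lambda>x. ?g' (f x) b)"
        using Suc.prems b by (intro Suc.IH Ck_SucD[OF Suc.prems(2)]) simp
    qed
  qed
qed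

lemma Ck_Pair:
  fixes f :: "'a::euclidean_space \<Rightarrow> 'b::euclidean_space" and g :: "'a \<Rightarrow> 'c::euclidean_space"
  assumes "open U" "Ck k U f" "Ck k U g"
  shows "Ck k U (\<lambda>x. (f x, g x))"
proof -
  have "bounded_linear (\<lambda>x::'b. (x, 0::'c))" "bounded_linear (\<lambda>x::'c. (0::'b, x))"
    by (intro bounded_linear_Pair bounded_linear_ident bounded_linear_zero)+
  then have "Ck k U (\<lambda>x. (f x, 0::'c))" "Ck k U (\<lambda>x. (0::'b, g x))"
    using Ck_bounded_linear[OF assms(1) _ assms(2)] Ck_bounded_linear[OF assms(1) _ assms(3)] by blast+
  from Ck_add[OF assms(1) this]
  show ?thesis by simp
qed

section \<open>Functions of one real variable: derivatives, increasing maps and their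
  inverses\<close>

lemma Ck_Suc_realI:
  fixes f :: "real \<Rightarrow> real"
  assumes "open U" "\<And>x. x \<in> U \<Longrightarrow> (f has_real_derivative f' x) (at x)" "Ck k U f'"
  shows "Ck (Suc k) U f"
  by (rule Ck_SucI[OF assms(1) assms(2)[unfolded has_field_derivative_def]]) (use assms(3) in simp_all)

lemma Ck_Suc_realD:
  fixes f :: "real \<Rightarrow> real"
  assumes "open U" "Ck (Suc k) U f"
  shows "\<And>x. x \<in> U \<Longrightarrow> (f has_real_derivative deriv f x) (at x)" "Ck k U (deriv f)"
proof -
  have eq: "frechet_derivative f (at x) 1 = deriv f x"
    and d: "(f has_real_derivative deriv f x) (at x)" if x: "x \<in> U" for x
  proof -
    have "f differentiable at x" using assms(2) x by simp
    then show d: "(f has_real_derivative deriv f x) (at x)"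
      using DERIV_deriv_iff_real_differentiable by blast
    show "frechet_derivative f (at x) 1 = deriv f x"
      using frechet_derivative_at[OF d[unfolded has_field_derivative_def]] by (metis mult.right_neutral)
  qed
  show "\<And>x. x \<in> U \<Longrightarrow> (f has_real_derivative deriv f x) (at x)" by (fact d)
  have "Ck k U (\<lambda>x. frechet_derivative f (at x) 1)" using assms(2) by simp
  then show "Ck k U (deriv f)"
    using Ck_cong_open[OF assms(1), of "\<lambda>x. frechet_derivative f (at x) 1" "deriv f"] eq by blast
qed


lemma Ck_inverse_real: "Ck k {0<..} (inverse :: real \<Rightarrow> real)"
proof (induction k)
  case 0
  show ?case by (auto intro!: continuous_intros)
next
  case (Suc k)
  have "Ck k {0<..} (\<lambda>x::real. (-1) *\<^sub>R (inverse x * inverse x))"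
    by (intro Ck_scaleR Ck_mult Ck_const Suc) auto
  then have "Ck k {0<..} (\<lambda>x::real. - (inverse x * inverse x))" by simp
  moreover have "(inverse has_real_derivative - (inverse x * inverse x)) (at x)" if "x \<in> {0<..}" for x :: real
    using DERIV_inverse[of x UNIV] that by (auto simp: numeral_2_eq_2)
  ultimately show ?case by (intro Ck_Suc_realI) auto
qed

text \<open>All finite orders are demanded, so transitions of this kind are of class
  \<open>C^r\<close> for every \<open>r\<close>, including infinity. \<open>I\<close> may be
  disconnected, so \<open>u\<close> is only locally increasing and injectivity is assumed separately
  where it matters; the positive derivative is what makes the inverse smooth.\<close>

definition smooth_inc :: "real set \<Rightarrow> (real \<Rightarrow> real) \<Rightarrow> bool" where
  "smooth_inc I u \<longleftrightarrow> open I \<and> (\<forall>k. Ck k I u) \<and> (\<forall>x\<in>I. deriv u x > 0)"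

lemma smooth_incD:
  assumes "smooth_inc I u"
  shows "open I" "Ck k I u" "Ck k I (deriv u)" "x \<in> I \<Longrightarrow> (u has_real_derivative deriv u x) (at x)"
    "x \<in> I \<Longrightarrow> deriv u x > 0" "continuous_on I u"
  using assms Ck_Suc_realD[of I k u] Ck_imp_continuous_on unfolding smooth_inc_def by blast+

lemma smooth_incI:
  assumes "open I" "\<And>x. x \<in> I \<Longrightarrow> (u has_real_derivative u' x) (at x)" "\<And>x. x \<in> I \<Longrightarrow> u' x > 0"
    "\<And>k. Ck k I u'"
  shows "smooth_inc I u"
  unfolding smooth_inc_def
proof (intro conjI allI ballI)
  show "Ck k I u" for k
    using Ck_Suc_realI[OF assms(1,2,4)] by (rule Ck_SucD)
  show "deriv u x > 0" if "x \<in> I" for x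
    using assms(2,3)[OF that] DERIV_imp_deriv by fastforce
qed (fact assms(1))

lemma smooth_inc_subset: "smooth_inc I u \<Longrightarrow> J \<subseteq> I \<Longrightarrow> open J \<Longrightarrow> smooth_inc J u"
  unfolding smooth_inc_def using Ck_subset by blast

lemma smooth_inc_cong:
  assumes "smooth_inc I u" "\<And>x. x \<in> I \<Longrightarrow> u x = v x"
  shows "smooth_inc I v"
proof (rule smooth_incI)
  show "(v has_real_derivative deriv u x) (at x)" if "x \<in> I" for x
    using has_field_derivative_transform_within_open[OF smooth_incD(4)[OF assms(1) that] smooth_incD(1)[OF assms(1)] that]
      assms(2) by blast
qed (use smooth_incD[OF assms(1)] in auto)

lemma smooth_inc_local:
  assumes "\<And>x. x \<in> I \<Longrightarrow> \<exists>J. x \<in> J \<and> J \<subseteq> I \<and> smooth_inc J u"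
  shows "smooth_inc I u"
  unfolding smooth_inc_def
proof (intro conjI allI ballI)
  show "open I" using assms smooth_incD(1) by (subst open_subopen) metis
  show "Ck k I u" for k
  proof (rule Ck_local)
    fix x assume "x \<in> I"
    then obtain J where "x \<in> J" "smooth_inc J u" using assms[of x] by metis
    then show "\<exists>V. open V \<and> x \<in> V \<and> Ck k V u" by (intro exI[of _ J] conjI smooth_incD)
  qed
  show "deriv u x > 0" if x: "x \<in> I" for x
  proof -
    obtain J where "x \<in> J" "smooth_inc J u" using assms[OF x] by blast
    then show ?thesis using smooth_incD(5)[of J u x] by simp
  qed
qed

lemma smooth_inc_compose:
  assumes "smooth_inc I u" "smooth_inc J v" "u ` I \<subseteq> J"
  shows "smooth_inc I (\<lambda>x. v (u x))"
proof (rule smooth_incI[OF smooth_incD(1)[OF assms(1)]])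
  fix x assume x: "x \<in> I"
  then have ux: "u x \<in> J" using assms(3) by blast
  show "((\<lambda>x. v (u x)) has_real_derivative deriv v (u x) * deriv u x) (at x)"
    by (rule DERIV_chain2[OF smooth_incD(4)[OF assms(2) ux] smooth_incD(4)[OF assms(1) x]])
  show "deriv v (u x) * deriv u x > 0"
    using smooth_incD(5)[OF assms(2) ux] smooth_incD(5)[OF assms(1) x] by simp
next
  show "Ck k I (\<lambda>x. deriv v (u x) * deriv u x)" for k
    by (rule Ck_mult[OF smooth_incD(1)[OF assms(1)] Ck_compose[OF smooth_incD(1)[OF assms(1)] assms(3)
        smooth_incD(3)[OF assms(2)] smooth_incD(2)[OF assms(1)]] smooth_incD(3)[OF assms(1)]])
qed

lemma smooth_inc_open_image:
  assumes "smooth_inc I u" "inj_on u I" "J \<subseteq> I" "open J"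
  shows "open (u ` J)"
  using assms smooth_incD(6)[OF assms(1)]
  by (metis continuous_on_subset inj_on_subset invariance_of_domain)

text \<open>Invariance of domain makes the image open, and the derivative of the inverse is
  \<open>inverse (deriv u (?v y))\<close>. This expresses the derivative through \<open>?v\<close>
  itself, so class \<open>C^k\<close> of \<open>?v\<close> forces class
  \<open>C^(k+1)\<close>.\<close>

lemma smooth_inc_inverse:
  assumes u: "smooth_inc I u" and inj: "inj_on u I"
  shows "smooth_inc (u ` I) (inv_into I u)"
proof -
  let ?v = "inv_into I u"
  have op: "open (u ` I)" using smooth_inc_open_image[OF u inj order_refl smooth_incD(1)[OF u]] .
  have vu: "?v (u x) = x" if "x \<in> I" for x using inj that by simp
  have cont: "continuous_on (u ` I) ?v"
    by (rule continuous_on_inverse_open_map[where S = I and f = u])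
      (use smooth_incD(6)[OF u] inv_into_f_f[OF inj] smooth_inc_open_image[OF u inj] smooth_incD(1)[OF u] in
       \<open>auto simp: openin_open_eq\<close>)
  have der: "(?v has_real_derivative inverse (deriv u (?v y))) (at y)" if y: "y \<in> u ` I" for y
  proof -
    obtain x where x: "x \<in> I" "y = u x" using y by blast
    show ?thesis
    proof (rule has_field_derivative_inverse_basic)
      show "(u has_real_derivative deriv u (?v y)) (at (?v y))"
        using smooth_incD(4)[OF u x(1)] x vu by simp
      show "deriv u (?v y) \<noteq> 0" using smooth_incD(5)[OF u x(1)] x vu by simp
      show "continuous (at y) ?v" using cont op y continuous_on_eq_continuous_at by blast
    qed (use op y in \<open>auto intro: f_inv_into_f\<close>)
  qed
  have "Ck k (u ` I) ?v" for k
  proof (induction k)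
    case 0
    show ?case using cont by simp
  next
    case (Suc k)
    have "Ck k (u ` I) (\<lambda>y. inverse (deriv u (?v y)))"
    proof (rule Ck_compose[OF op _ Ck_inverse_real])
      show "(\<lambda>y. deriv u (?v y)) ` u ` I \<subseteq> {0<..}"
        using vu smooth_incD(5)[OF u] by auto
      show "Ck k (u ` I) (\<lambda>y. deriv u (?v y))"
        by (rule Ck_compose[OF op _ smooth_incD(3)[OF u] Suc]) (use vu in auto)
    qed
    then show ?case using Ck_Suc_realI[OF op der] by blast
  qed
  then show ?thesis
    unfolding smooth_inc_def
  proof (intro conjI ballI)
    fix y assume y: "y \<in> u ` I"
    then have "deriv ?v y = inverse (deriv u (?v y))" using der DERIV_imp_deriv by blast
    moreover have "?v y \<in> I" using y by (rule inv_into_into)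
    ultimately show "deriv ?v y > 0" using smooth_incD(5)[OF u] by simp
  qed (use op in auto)
qed

section \<open>Flat functions and smooth cut-offs\<close>

definition flat :: "real poly \<Rightarrow> real \<Rightarrow> real" where
  "flat p x = (if x > 0 then poly p (inverse x) * exp (- inverse x) else 0)"

text \<open>The polynomial is $t^2 (p(t) - p'(t))$, from differentiating $p(t) e^{-t}$ with $t = 1/x$.\<close>
lemma DERIV_flat:
  "(flat p has_real_derivative flat ([:0, 0, 1:] * (p - pderiv p)) x) (at x)"
proof -
  consider "x > 0" | "x < 0" | "x = 0" by linarith
  then show ?thesis
  proof cases
    case 1
    have "((\<lambda>x. poly p (inverse x) * exp (- inverse x)) has_real_derivative
        flat ([:0, 0, 1:] * (p - pderiv p)) x) (at x)"
    proof -
      have inv: "(inverse has_real_derivative - (inverse x * inverse x)) (at x)"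
        using DERIV_inverse[of x UNIV] 1 by (auto simp: numeral_2_eq_2)
      have exp: "((\<lambda>x. exp (- inverse x)) has_real_derivative
          exp (- inverse x) * - (- (inverse x * inverse x))) (at x)"
        by (rule DERIV_chain2[OF DERIV_exp DERIV_minus[OF inv]])
      show ?thesis
        by (rule DERIV_mult[OF DERIV_chain2[OF poly_DERIV inv] exp, THEN back_subst[where P = "\<lambda>D. (_ has_real_derivative D) (at x)"]])
          (use 1 in \<open>simp add: flat_def algebra_simps\<close>)
    qed
    then show ?thesis
      by (rule has_field_derivative_transform_within_open[where S = "{0<..}"]) (use 1 in \<open>auto simp: flat_def\<close>)
  next
    case 2
    have "((\<lambda>x. 0) has_real_derivative 0) (at x)" by simp
    then show ?thesis
      using 2 has_field_derivative_transform_within_open[where S = "{..<0}" and f = "\<lambda>x. 0" and g = "flat p"]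
      by (auto simp: flat_def)
  next
    case 3
    have "((\<lambda>t. poly q t * exp (- t)) \<longlongrightarrow> 0) at_top" for q :: "real poly"
    proof -
      have "((\<lambda>t. \<Sum>i\<le>degree q. coeff q i * (t ^ i / exp t)) \<longlongrightarrow> 0) at_top"
        by (intro tendsto_null_sum tendsto_mult_right_zero tendsto_power_div_exp_0)
      then show ?thesis
        by (simp add: poly_altdef sum_divide_distrib exp_minus field_simps)
    qed
    \<comment> \<open>The difference quotient at \<open>0\<close> is \<open>flat p y / y\<close>;
      with \<open>t = inverse y\<close> it becomes \<open>t p(t) exp(-t)\<close>, hence the extra
      factor \<open>[:0, 1:]\<close>.\<close>
    from filterlim_compose[OF this[of "[:0, 1:] * p"] filterlim_inverse_at_top_right]
    have "((\<lambda>x. poly ([:0, 1:] * p) (inverse x) * exp (- inverse x)) \<longlongrightarrow> 0) (at_right 0)" .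
    then have "((\<lambda>y. (flat p y - flat p 0) / (y - 0)) \<longlongrightarrow> 0) (at_right 0)"
      by (rule Lim_transform_eventually)
        (auto simp: eventually_at_filter flat_def field_simps)
    moreover have "((\<lambda>y. (flat p y - flat p 0) / (y - 0)) \<longlongrightarrow> 0) (at_left 0)"
      by (rule Lim_transform_eventually[OF tendsto_const])
        (auto simp: eventually_at_filter flat_def)
    ultimately show ?thesis
      using 3 by (simp add: has_field_derivative_iff filterlim_split_at flat_def)
  qed
qed

text \<open>The family \<open>flat p\<close> is closed under differentiation, which the single
  function \<open>exp (-1/x)\<close> is not; this is why arbitrary polynomials are carried
  along.\<close>

lemma Ck_flat: "Ck k UNIV (flat p)"
proof (induction k arbitrary: p)
  case 0
  show ?case using DERIV_flat by (metis Ck.simps(1) DERIV_isCont continuous_at_imp_continuous_on)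
next
  case (Suc k)
  show ?case by (rule Ck_Suc_realI[OF open_UNIV DERIV_flat Suc])
qed

text \<open>The classical function \<open>exp (-1/x)\<close> extended by zero: nondecreasing,
  positive exactly on the positive reals and flat at \<open>0\<close>.\<close>

definition smooth_step :: "real \<Rightarrow> real" where "smooth_step = flat 1"

lemma smooth_step_simps:
  "x \<le> 0 \<Longrightarrow> smooth_step x = 0" "x > 0 \<Longrightarrow> smooth_step x > 0" "smooth_step x \<ge> 0"
  "x \<le> y \<Longrightarrow> smooth_step x \<le> smooth_step y"
  by (auto simp: smooth_step_def flat_def)

lemma Ck_smooth_step_compose:
  assumes "open U" "Ck k U f"
  shows "Ck k U (\<lambda>x. smooth_step (f x))"
  unfolding smooth_step_def by (rule Ck_compose[OF assms(1) _ Ck_flat assms(2)]) simp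

lemma smooth_inc_strict_mono:
  assumes "smooth_inc I u" "is_interval I"
  shows "strict_mono_on I u"
proof (rule strict_mono_onI)
  fix x y assume xy: "x \<in> I" "y \<in> I" "x < y"
  then have "{x..y} \<subseteq> I" using assms(2) by (meson atLeastAtMost_iff mem_is_interval_1_I subsetI)
  then show "u x < u y"
    using DERIV_pos_imp_increasing[OF xy(3), of u] smooth_incD(4,5)[OF assms(1)]
    by (metis atLeastAtMost_iff subset_iff)
qed

text \<open>Endpoints are taken in the extended reals, so that bounded and unbounded intervals are
  covered by the same \<open>einterval\<close> primitive.\<close>

lemma open_interval_antiderivative:
  fixes w :: "real \<Rightarrow> real"
  assumes "open I" "is_interval I" "continuous_on I w"
  obtains F where "\<And>x. x \<in> I \<Longrightarrow> (F has_real_derivative w x) (at x)"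
proof (cases "I = {}")
  case False
  obtain a b :: ereal where ab: "I = einterval a b" "a < b"
  proof -
    define a b where "a = (INF x\<in>I. ereal x)" and "b = (SUP x\<in>I. ereal x)"
    have "I = einterval a b"
    proof (intro set_eqI iffI)
      fix x assume x: "x \<in> I"
      then obtain e where e: "e > 0" "\<And>y. dist y x < e \<Longrightarrow> y \<in> I"
        using assms(1) by (meson open_dist)
      have "x - e/2 \<in> I" "x + e/2 \<in> I" by (rule e(2), use e(1) in \<open>simp add: dist_real_def\<close>)+
      then have "a \<le> x - e/2" "x + e/2 \<le> b"
        unfolding a_def b_def by (auto intro: INF_lower SUP_upper)
      moreover have "ereal (x - e/2) < ereal x" "ereal x < ereal (x + e/2)" using e(1) by simp_all
      ultimately show "x \<in> einterval a b"
        by (auto simp: einterval_def simp del: ereal_less_eq less_ereal.simps intro: le_less_trans less_le_trans)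
    next
      fix x assume "x \<in> einterval a b"
      then obtain y z where "y \<in> I" "y < x" "z \<in> I" "x < z"
        unfolding a_def b_def einterval_def by (auto simp: INF_less_iff less_SUP_iff)
      then show "x \<in> I" using assms(2) mem_is_interval_1_I less_imp_le by metis
    qed
    moreover have "a < b" using False calculation by (auto simp: einterval_def)
    ultimately show ?thesis using that by blast
  qed
  have "isCont w x" if "a < ereal x" "ereal x < b" for x
    using assms(1,3) that ab(1) by (simp add: continuous_on_eq_continuous_at einterval_def)
  from einterval_antiderivative[OF ab(2) this] obtain F
    where "\<And>x. a < ereal x \<Longrightarrow> ereal x < b \<Longrightarrow> (F has_vector_derivative w x) (at x)" by blast
  then show ?thesis
    using that ab(1) by (auto simp: einterval_def has_real_derivative_iff_has_vector_derivative)
qed (use that in auto)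

text \<open>The derivative of \<open>u\<close> is switched off just after \<open>p\<close> while a multiple of a positive function is switched
  on; the multiple is then tuned so that the primitive takes the value \<open>y\<close> at \<open>q\<close>.\<close>
lemma smooth_inc_extend:
  assumes u: "smooth_inc I u" and I: "p \<in> I" "I \<subseteq> J" "\<And>x. x \<in> J \<Longrightarrow> x \<le> p \<Longrightarrow> x \<in> I"
    and J: "open J" "is_interval J" "q \<in> J" "p < q" and y: "u p < y"
  obtains v where "smooth_inc J v" "\<And>x. x \<in> J \<Longrightarrow> x \<le> p \<Longrightarrow> v x = u x" "v q = y"
proof -
  have opI: "open I" by (rule smooth_incD(1)[OF u])
  have "isCont u p" using smooth_incD(4)[OF u I(1)] DERIV_isCont by blast
  then have "\<forall>\<^sub>F x in at p. u x < y"
    using y by (simp add: isCont_def order_tendstoD(2))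
  then obtain d1 where d1: "d1 > 0" "\<And>x. x \<noteq> p \<Longrightarrow> dist x p < d1 \<Longrightarrow> u x < y"
    by (auto simp: eventually_at)
  obtain d2 where d2: "d2 > 0" "\<And>x. dist x p < d2 \<Longrightarrow> x \<in> I"
    using opI I(1) by (metis open_dist)
  \<comment> \<open>\<open>e\<close> is so small that \<open>u\<close> is still below
    \<open>y\<close> at \<open>p + e\<close>; the room left there is what the added positive term
    will fill.\<close>
  define e where "e = min (min (d1/2) (d2/2)) (q - p)"
  have e: "e > 0" "p + e \<le> q" "u (p + e) < y" "{p..p+e} \<subseteq> I"
    using d1(1) d2(1) J(4) by (auto simp: e_def dist_real_def intro!: d1(2) d2(2))
  \<comment> \<open>\<open>A\<close> is a smooth cut-off, \<open>1\<close> up to \<open>p\<close>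
    and \<open>0\<close> from \<open>p + e\<close> on; \<open>B\<close> is positive exactly beyond
    \<open>p\<close>. Both are flat at \<open>p\<close>, so the modified derivative joins
    \<open>deriv u\<close> smoothly.\<close>
  define A where "A x = smooth_step (1 - smooth_step (x - p) / smooth_step e) / smooth_step 1" for x
  define B where "B x = smooth_step (x - p)" for x
  \<comment> \<open>Beyond \<open>p + e\<close> the point may lie outside \<open>I\<close>, where
    \<open>deriv u\<close> carries no information; the value there is set to
    \<open>0\<close>.\<close>
  define w where "w x = (if x < p + e then deriv u x * A x else 0)" for x
  have se: "smooth_step e > 0" and s1: "smooth_step 1 > 0" using e(1) smooth_step_simps(2) by auto
  have A1: "A x = 1" if "x \<le> p" for x
    using that s1 by (simp add: A_def smooth_step_simps(1))
  have A0: "A x = 0" if "x \<ge> p + e" for x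
  proof -
    have "smooth_step e \<le> smooth_step (x - p)" using that by (intro smooth_step_simps) simp
    then have "1 - smooth_step (x - p) / smooth_step e \<le> 0" using se by simp
    then show ?thesis by (simp add: A_def smooth_step_simps(1))
  qed
  have A_ge: "A x \<ge> 0" for x
    using s1 by (simp add: A_def smooth_step_simps(3))
  have A_le: "A x \<le> 1" for x
  proof -
    have "smooth_step (1 - smooth_step (x - p) / smooth_step e) \<le> smooth_step 1"
      using se smooth_step_simps(3)[of "x - p"] by (intro smooth_step_simps(4)) simp
    then show ?thesis using s1 by (simp add: A_def)
  qed
  have CB: "Ck k U B" if "open U" for k U
    unfolding B_def using Ck_add[OF that Ck_linear[OF that bounded_linear_ident] Ck_const[OF that, of k "-p"]]
    by (intro Ck_smooth_step_compose that) simp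
  have CA: "Ck k U A" if "open U" for k U
  proof -
    have "Ck k U (\<lambda>x. 1 + (- inverse (smooth_step e)) * smooth_step (x - p))"
      using CB[OF that] by (intro Ck_add Ck_mult Ck_const that) (simp add: B_def[abs_def])
    then have "Ck k U (\<lambda>x. 1 - smooth_step (x - p) / smooth_step e)"
      by (simp add: field_simps)
    then have "Ck k U (\<lambda>x. inverse (smooth_step 1) * smooth_step (1 - smooth_step (x - p) / smooth_step e))"
      by (intro Ck_mult Ck_const Ck_smooth_step_compose that)
    then show ?thesis by (simp add: A_def[abs_def] field_simps)
  qed
  have w_I: "w x = deriv u x * A x" for x by (simp add: w_def A0)
  have Cw: "Ck k J w" for k
  proof (rule Ck_local)
    fix x assume x: "x \<in> J"
    show "\<exists>V. open V \<and> x \<in> V \<and> Ck k V w"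
    proof (cases "x \<in> I")
      case True
      have "Ck k I w" unfolding w_I[abs_def]
        by (intro Ck_mult CA smooth_incD(3)[OF u] opI)
      then show ?thesis using True opI by blast
    next
      case False
      then have "x > p + e" using e(4) I(3)[OF x] by (metis atLeastAtMost_iff linorder_not_le subsetD nle_le)
      moreover have "Ck k {p+e<..} w"
        by (rule Ck_cong_open[OF _ _ Ck_const[of _ k 0]]) (auto simp: w_def)
      ultimately show ?thesis by (intro exI[of _ "{p+e<..}"]) auto
    qed
  qed
  have w_ge: "w x \<ge> 0" if "x \<in> J" for x
  proof (cases "x < p + e")
    case True
    then have "x \<in> I" using e(4) I(3)[OF that] by (metis atLeastAtMost_iff subsetD less_imp_le linorder_le_cases)
    then show ?thesis using smooth_incD(5)[OF u] A_ge[of x] by (simp add: w_def less_imp_le)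
  qed (simp add: w_def)
  obtain F where F: "\<And>x. x \<in> J \<Longrightarrow> (F has_real_derivative w x) (at x)"
    using open_interval_antiderivative[OF J(1,2) Ck_imp_continuous_on[OF Cw[of 0]]] by blast
  obtain G where G: "\<And>x. x \<in> J \<Longrightarrow> (G has_real_derivative B x) (at x)"
    using open_interval_antiderivative[OF J(1,2) Ck_imp_continuous_on[OF CB[OF J(1), of 0]]] by blast
  have seg: "{a..b} \<subseteq> J" if "a \<in> J" "b \<in> J" for a b
    using J(2) that by (meson atLeastAtMost_iff mem_is_interval_1_I subsetI)
  have "p + e \<in> {p..p + e}" using e(1) by simp
  then have pJ: "p \<in> J" "p + e \<in> J" using I(1,2) e(4) by blast+
  have "G p < G q"
  proof -
    have "\<exists>z. p < z \<and> z < q \<and> G q - G p = (q - p) * B z"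
      by (rule MVT2[OF J(4)]) (use G seg[OF pJ(1) J(3)] in auto)
    then show ?thesis using J(4) smooth_step_simps(2) unfolding B_def
      by (metis diff_gt_0_iff_gt zero_less_mult_iff)
  qed
  have "F q = F (p + e)"
  proof (cases "p + e < q")
    case True
    have "\<exists>z. p + e < z \<and> z < q \<and> F q - F (p + e) = (q - (p + e)) * w z"
      by (rule MVT2[OF True]) (use F seg[OF pJ(2) J(3)] in auto)
    then show ?thesis by (auto simp: w_def)
  qed (use e(2) in simp)
  \<comment> \<open>As \<open>A \<le> 1\<close>, the truncated derivative makes \<open>F\<close>
    rise no faster than \<open>u\<close>, so \<open>F\<close> alone falls short of the target
    \<open>y\<close> and the coefficient \<open>c\<close> comes out positive.\<close>
  moreover have "F (p + e) - F p \<le> u (p + e) - u p"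
  proof -
    have "(\<lambda>x. u x - F x) p \<le> (\<lambda>x. u x - F x) (p + e)"
    proof (rule DERIV_nonneg_imp_nondecreasing[of p "p + e" "\<lambda>x. u x - F x"])
      fix x assume x: "p \<le> x" "x \<le> p + e"
      then have xI: "x \<in> I" using e(4) by auto
      have "((\<lambda>x. u x - F x) has_real_derivative deriv u x - w x) (at x)"
        using smooth_incD(4)[OF u xI] F xI I(2) by (intro derivative_intros) auto
      moreover have "deriv u x - w x \<ge> 0"
        using A_le[of x] smooth_incD(5)[OF u xI] unfolding w_I by (simp add: mult_left_le)
      ultimately show "\<exists>y. ((\<lambda>x. u x - F x) has_real_derivative y) (at x) \<and> y \<ge> 0" by blast
    qed (use e(1) in simp)
    then show ?thesis by simp
  qed
  ultimately have gap: "y - u p - (F q - F p) > 0" using e(3) by simp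
  define c where "c = (y - u p - (F q - F p)) / (G q - G p)"
  have c: "c > 0" using gap \<open>G p < G q\<close> by (simp add: c_def)
  define v where "v x = u p + (F x - F p) + c * (G x - G p)" for x
  have v': "(v has_real_derivative w x + c * B x) (at x)" if "x \<in> J" for x
    unfolding v_def[abs_def] by (rule derivative_eq_intros F[OF that] G[OF that] refl | simp)+
  show ?thesis
  proof
    show "smooth_inc J v"
    proof (rule smooth_incI[OF J(1) v'])
      fix x assume x: "x \<in> J"
      show "w x + c * B x > 0"
      proof (cases "x \<le> p")
        case True
        then show ?thesis using I(3)[OF x] smooth_incD(5)[OF u] e(1)
          by (simp add: w_def A1 B_def smooth_step_simps(1))
      next
        case False
        then show ?thesis using w_ge[OF x] c smooth_step_simps(2)[of "x - p"]
          by (simp add: B_def add_nonneg_pos)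
      qed
    next
      show "Ck k J (\<lambda>x. w x + c * B x)" for k
        by (intro Ck_add Ck_mult Ck_const Cw CB J(1))
    qed
    show "v q = y" using \<open>G p < G q\<close> by (simp add: v_def c_def)
    fix x assume x: "x \<in> J" "x \<le> p"
    show "v x = u x"
    proof (cases "x = p")
      case False
      then have "x < p" using x by simp
      have "v p - u p = v x - u x"
      proof (rule DERIV_isconst2[OF \<open>x < p\<close>])
        have der: "((\<lambda>x. v x - u x) has_real_derivative 0) (at z)" if "x \<le> z" "z \<le> p" for z
        proof -
          have zJ: "z \<in> J" using seg[OF x(1) pJ(1)] that by auto
          then have zI: "z \<in> I" using I(3) that by blast
          have "((\<lambda>x. v x - u x) has_real_derivative (w z + c * B z) - deriv u z) (at z)"
            by (intro derivative_intros v' smooth_incD(4)[OF u] zI zJ)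
          then show ?thesis using that e(1) by (simp add: w_def A1 B_def smooth_step_simps(1))
        qed
        show "((\<lambda>x. v x - u x) has_real_derivative 0) (at z)" if "x < z" "z < p" for z
          using der that by simp
        show "continuous_on {x..p} (\<lambda>x. v x - u x)"
          using der by (intro continuous_at_imp_continuous_on ballI DERIV_isCont) auto
      qed (use x in auto)
      then show ?thesis by (simp add: v_def)
    qed (simp add: v_def)
  qed
qed

section \<open>The long ray as a linearly ordered space\<close>

unbundle cardinal_syntax

section \<open>The first uncountable ordinal as a type\<close>

lemma Well_order_omega1: "Well_order omega1"
  unfolding omega1_def
  by (rule card_order_on_well_order_on[OF cardSuc_Card_order[OF natLeq_Card_order]])

lemma order_omega1: "trans omega1" "antisym omega1" "Total omega1" "wf (omega1 - Id)" "Refl omega1"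
  using Well_order_omega1 by (simp_all add: order_on_defs)

lemma uncountable_Field_omega1: "uncountable (Field omega1)"
proof
  assume "countable (Field omega1)"
  then have "|Field omega1| \<le>o natLeq" by (simp add: countable_card_le_natLeq)
  moreover have "|Field omega1| =o omega1"
    unfolding omega1_def by (rule card_of_Field_ordIso[OF cardSuc_Card_order[OF natLeq_Card_order]])
  ultimately have "omega1 \<le>o natLeq" using ordIso_ordLeq_trans ordIso_symmetric by blast
  moreover have "natLeq <o omega1" unfolding omega1_def using cardSuc_greater natLeq_Card_order by blast
  ultimately show False using not_ordLess_ordLeq by blast
qed

text \<open>Turning the field of the relation \<open>omega1\<close> into a type makes its order a
  class instance, so that well-founded induction, \<open>LEAST\<close> and the order lemmas apply
  directly.\<close>

typedef om = "Field omega1"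
  using uncountable_Field_omega1 by (metis countable_empty ex_in_conv)

instantiation om :: wellorder
begin

definition less_eq_om :: "om \<Rightarrow> om \<Rightarrow> bool" where
  "a \<le> b \<longleftrightarrow> (Rep_om a, Rep_om b) \<in> omega1"

definition less_om :: "om \<Rightarrow> om \<Rightarrow> bool" where
  "a < b \<longleftrightarrow> (Rep_om a, Rep_om b) \<in> omega1 \<and> a \<noteq> b"

instance
proof
  fix a b c :: om and P :: "om \<Rightarrow> bool"
  show "(a < b) = (a \<le> b \<and> \<not> b \<le> a)"
    unfolding less_eq_om_def less_om_def
    by (metis Rep_om Rep_om_inject antisymD order_omega1(2,5) refl_onD)
  show "a \<le> a"
    unfolding less_eq_om_def using Rep_om order_omega1(5) refl_onD by metis
  show "a \<le> b \<Longrightarrow> b \<le> c \<Longrightarrow> a \<le> c"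
    unfolding less_eq_om_def using order_omega1(1) transD by metis
  show "a \<le> b \<Longrightarrow> b \<le> a \<Longrightarrow> a = b"
    unfolding less_eq_om_def using order_omega1(2) antisymD Rep_om_inject by metis
  show "a \<le> b \<or> b \<le> a"
    using order_omega1(3,5) Rep_om unfolding total_on_def less_eq_om_def by (metis refl_onD)
  assume IH: "\<And>x. (\<And>y. y < x \<Longrightarrow> P y) \<Longrightarrow> P x"
  have "wf (inv_image (omega1 - Id) Rep_om)" using order_omega1(4) by (rule wf_inv_image)
  then show "P a"
    by (induction a rule: wf_induct_rule)
      (use IH in \<open>auto simp: less_om_def inv_image_def Rep_om_inject\<close>)
qed

end

text \<open>A proper initial segment of a successor cardinal has smaller cardinality, hence at most
  that of the naturals.\<close>

lemma countable_lessThan_om: "countable {..<a::om}"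
proof -
  let ?u = "underS omega1 (Rep_om a)"
  have "|?u| <o omega1"
    unfolding omega1_def
    by (rule card_of_underS[OF cardSuc_Card_order[OF natLeq_Card_order]]) (use Rep_om omega1_def in simp)
  then have "|?u| \<le>o natLeq"
    unfolding omega1_def
    using cardSuc_ordLeq_ordLess[OF natLeq_Card_order card_of_Card_order] by blast
  then have "countable ?u" by (simp add: countable_card_le_natLeq)
  moreover have "Rep_om ` {..<a} \<subseteq> ?u"
    by (auto simp: underS_def less_om_def Rep_om_inject)
  ultimately have "countable (Rep_om ` {..<a})" by (rule countable_subset[rotated])
  then show ?thesis
    by (rule countable_image_inj_on) (simp add: inj_on_def Rep_om_inject)
qed

lemma countable_atMost_om: "countable {..a::om}"
proof -
  have "{..a} = insert a {..<a}" by auto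
  then show ?thesis using countable_lessThan_om by simp
qed

lemma uncountable_om: "uncountable (UNIV :: om set)"
  using uncountable_Field_omega1
  by (metis countable_image type_definition.Rep_range type_definition_om)

text \<open>Regularity of the first uncountable ordinal: countably many countable initial segments
  cannot cover an uncountable type. Every closing-off argument below rests on this.\<close>

lemma countable_bounded_om:
  assumes "countable (X :: om set)"
  obtains b where "\<And>a. a \<in> X \<Longrightarrow> a < b"
proof -
  have "countable (\<Union>a\<in>X. {..a})"
    using assms countable_atMost_om by blast
  then obtain b where "b \<notin> (\<Union>a\<in>X. {..a})"
    using uncountable_om by (metis UNIV_eq_I)
  then have "\<And>a. a \<in> X \<Longrightarrow> a < b" by (meson UN_I atMost_iff not_le)
  then show ?thesis by (rule that)
qed

lemma ex_greater_om: "\<exists>b. a < (b::om)"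
  using countable_bounded_om[of "{a}"] by (metis countable_empty countable_insert insertI1)

definition om_zero :: om where "om_zero = (LEAST a. True)"

lemma om_zero_le [simp]: "om_zero \<le> a"
  unfolding om_zero_def by (rule Least_le) simp

lemma om_zero_less_iff: "om_zero < a \<longleftrightarrow> a \<noteq> om_zero"
  by (metis less_irrefl less_le om_zero_le)

lemma Rep_om_zero: "Rep_om om_zero = omega1_zero"
proof -
  have ex: "Rep_om om_zero \<in> Field omega1 \<and> (\<forall>b\<in>Field omega1. (Rep_om om_zero, b) \<in> omega1)"
    using Rep_om om_zero_le unfolding less_eq_om_def by (metis Rep_om_cases)
  then have "omega1_zero \<in> Field omega1 \<and> (\<forall>b\<in>Field omega1. (omega1_zero, b) \<in> omega1)"
    unfolding omega1_zero_def by (rule someI)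
  then show ?thesis using ex order_omega1(2) antisymD by metis
qed

text \<open>The long ray as a type of pairs of block and offset, to be given its order topology.
  Continuity and limits can then be handled by type classes, and \<open>toL\<close> carries the
  results over to the topology \<open>Lplus\<close>.\<close>

typedef ll = "{p :: om \<times> real. 0 \<le> snd p \<and> snd p < 1 \<and> p \<noteq> (om_zero, 0)}"
  by (rule exI[of _ "(om_zero, 1/2)"]) simp

setup_lifting type_definition_ll

lift_definition blk :: "ll \<Rightarrow> om" is fst .
lift_definition off :: "ll \<Rightarrow> real" is snd .

lemma ll_eqI: "blk x = blk y \<Longrightarrow> off x = off y \<Longrightarrow> x = y"
  by transfer (simp add: prod_eq_iff)

lemma off_bounds: "0 \<le> off x" "off x < 1" "blk x = om_zero \<Longrightarrow> 0 < off x"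
  by (transfer, simp add: prod_eq_iff less_le)+

lemma ex_ll:
  assumes "0 \<le> s" "s < 1" "a = om_zero \<Longrightarrow> s > 0"
  obtains x where "blk x = a" "off x = s"
  using assms
  by (transfer, metis fst_conv less_irrefl mem_Collect_eq prod.inject snd_conv)

instantiation ll :: linorder
begin

definition less_ll :: "ll \<Rightarrow> ll \<Rightarrow> bool" where
  "x < y \<longleftrightarrow> blk x < blk y \<or> blk x = blk y \<and> off x < off y"

definition less_eq_ll :: "ll \<Rightarrow> ll \<Rightarrow> bool" where
  "x \<le> y \<longleftrightarrow> blk x < blk y \<or> blk x = blk y \<and> off x \<le> off y"

instance
  by standard (auto simp: less_ll_def less_eq_ll_def intro: ll_eqI)

end

instantiation ll :: linorder_topology
begin

definition open_ll :: "ll set \<Rightarrow> bool" where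
  "open_ll = generate_topology (range (\<lambda>a. {..<a}) \<union> range (\<lambda>a. {a<..}))"

instance
  by standard (simp add: open_ll_def)

end

instance ll :: dense_linorder
proof
  fix x y :: ll
  assume "x < y"
  then consider "blk x < blk y" | "blk x = blk y" "off x < off y" unfolding less_ll_def by blast
  then show "\<exists>z. x < z \<and> z < y"
  proof cases
    case 1
    obtain z where "blk z = blk x" "off z = (off x + 1) / 2"
      using ex_ll[of "(off x + 1) / 2" "blk x"] off_bounds[of x] by auto
    then show ?thesis using 1 off_bounds(2)[of x] by (intro exI[of _ z]) (auto simp: less_ll_def)
  next
    case 2
    obtain z where "blk z = blk x" "off z = (off x + off y) / 2"
      using ex_ll[of "(off x + off y) / 2" "blk x"] off_bounds[of x] off_bounds[of y] 2 by auto
    then show ?thesis using 2 by (intro exI[of _ z]) (auto simp: less_ll_def)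
  qed
qed

lemma blk_mono: "x \<le> y \<Longrightarrow> blk x \<le> blk y"
  by (auto simp: less_eq_ll_def)

lemma ex_greater_ll: "\<exists>y. x < (y::ll) \<and> blk y = blk x"
proof -
  obtain z where "blk z = blk x" "off z = (off x + 1) / 2"
    using ex_ll[of "(off x + 1) / 2" "blk x"] off_bounds[of x] by auto
  then show ?thesis using off_bounds(2)[of x] by (intro exI[of _ z]) (auto simp: less_ll_def)
qed

lemma ex_less_ll: "\<exists>y. y < (x::ll)"
proof (cases "blk x = om_zero")
  case True
  obtain z where "blk z = blk x" "off z = off x / 2"
    using ex_ll[of "off x / 2" "blk x"] off_bounds[of x] True by auto
  then show ?thesis using off_bounds(3)[OF True] by (intro exI[of _ z]) (auto simp: less_ll_def)
next
  case False
  obtain z where "blk z = om_zero" "off z = 1/2" using ex_ll[of "1/2" om_zero] by auto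
  then show ?thesis using False by (intro exI[of _ z]) (auto simp: less_ll_def om_zero_less_iff)
qed

text \<open>Dense in the ray and countable below every block: although the ray is not separable,
  each of its initial segments is.\<close>

definition rat_points :: "ll set" where "rat_points = {x. off x \<in> \<rat>}"

lemma rat_points_dense: "x < y \<Longrightarrow> \<exists>z\<in>rat_points. x < z \<and> z < y"
proof -
  have *: "\<exists>z\<in>rat_points. x < z \<and> z < y" if e: "blk x = blk y" "off x < off y" for x y
  proof -
    obtain s where s: "s \<in> \<rat>" "off x < s" "s < off y" using Rats_dense_in_real[OF e(2)] by blast
    obtain z where "blk z = blk x" "off z = s"
      using ex_ll[of s "blk x"] off_bounds[of x] off_bounds[of y] s by auto
    then show ?thesis using s e by (intro bexI[of _ z]) (auto simp: less_ll_def rat_points_def)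
  qed
  assume xy: "x < y"
  show ?thesis
  proof (cases "blk x = blk y")
    case False
    then have "blk x < blk y" using xy by (auto simp: less_ll_def)
    moreover obtain z where "x < z" "blk z = blk x" using ex_greater_ll by blast
    ultimately have "\<exists>w\<in>rat_points. x < w \<and> w < z" using *[of x z] by (auto simp: less_ll_def)
    then show ?thesis using \<open>blk x < blk y\<close> \<open>blk z = blk x\<close>
      by (metis less_ll_def order.strict_trans)
  qed (use xy * in \<open>auto simp: less_ll_def\<close>)
qed

lemma countable_rat_points: "countable (rat_points \<inter> {x. blk x \<le> a})"
proof -
  have "countable ({..a} \<times> (\<rat> :: real set))"
    using countable_atMost_om countable_rat by blast
  moreover have "(\<lambda>x. (blk x, off x)) ` (rat_points \<inter> {x. blk x \<le> a}) \<subseteq> {..a} \<times> \<rat>"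
    by (auto simp: rat_points_def)
  ultimately have "countable ((\<lambda>x. (blk x, off x)) ` (rat_points \<inter> {x. blk x \<le> a}))"
    using countable_subset by blast
  then show ?thesis by (rule countable_image_inj_on) (auto simp: inj_on_def intro: ll_eqI)
qed

lemma open_ll_interval:
  assumes "open (W :: ll set)" "x \<in> W"
  obtains a b where "a < x" "x < b" "{a<..<b} \<subseteq> W"
proof -
  obtain a where a: "a < x" "{a<..x} \<subseteq> W" using open_left[OF assms] ex_less_ll by metis
  obtain b where b: "x < b" "{x..<b} \<subseteq> W" using open_right[OF assms] ex_greater_ll by metis
  have "{a<..<b} \<subseteq> {a<..x} \<union> {x..<b}" by auto
  then show ?thesis using that[OF a(1) b(1)] a(2) b(2) by blast
qed

section \<open>Identification with the given topology of the long ray\<close>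

definition toL :: "ll \<Rightarrow> lpt" where "toL x = (Rep_om (blk x), off x)"

lemma inj_toL: "inj toL"
  by (auto simp: inj_def toL_def Rep_om_inject intro: ll_eqI)

lemma lex_less_toL: "lex_less (toL x) (toL y) \<longleftrightarrow> x < y"
  by (auto simp: lex_less_def toL_def less_ll_def less_om_def Rep_om_inject)

lemma range_toL: "range toL = Lgeq_set - {(omega1_zero, 0)}"
proof (intro set_eqI iffI)
  fix p assume "p \<in> range toL"
  then obtain x where p: "p = toL x" by blast
  have "toL x \<noteq> (omega1_zero, 0)"
    using off_bounds(3)[of x] by (auto simp: toL_def Rep_om_zero[symmetric] Rep_om_inject)
  then show "p \<in> Lgeq_set - {(omega1_zero, 0)}"
    using Rep_om[of "blk x"] off_bounds(1,2)[of x] p by (simp add: Lgeq_set_def toL_def)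
next
  fix p assume p: "p \<in> Lgeq_set - {(omega1_zero, 0)}"
  then obtain a where a: "fst p = Rep_om a"
    unfolding Lgeq_set_def using Rep_om_cases by (metis DiffD1 mem_Times_iff)
  have "0 \<le> snd p" "snd p < 1" using p unfolding Lgeq_set_def by auto
  moreover have "a = om_zero \<Longrightarrow> snd p \<noteq> 0" using p a Rep_om_zero by (metis DiffD2 insertI1 prod.collapse)
  ultimately obtain x where "blk x = a" "off x = snd p" using ex_ll[of "snd p" a] by force
  then have "p = toL x" using a by (simp add: toL_def prod_eq_iff)
  then show "p \<in> range toL" by blast
qed

definition fromL :: "lpt \<Rightarrow> ll" where "fromL = inv toL"

lemma fromL_toL [simp]: "fromL (toL x) = x"
  by (simp add: fromL_def inj_toL)

lemma lex_less_zero: "lex_less (omega1_zero, 0) (toL x)" "\<not> lex_less (toL x) (omega1_zero, 0)"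
  using om_zero_le[of "blk x"] antisym[OF _ om_zero_le, of "blk x"] off_bounds[of x]
  by (auto simp: lex_less_def toL_def Rep_om_zero[symmetric] less_eq_om_def[symmetric] Rep_om_inject)

text \<open>The space of a generated topology is only the union of its generators, so each point
  must be seen to lie in one of them; since there is no greatest element, every point lies below
  another.\<close>

lemma topspace_Lgeq: "topspace Lgeq = Lgeq_set"
proof -
  have top: "topspace Lgeq = {q \<in> Lgeq_set. \<exists>p\<in>Lgeq_set. lex_less q p \<or> lex_less p q}"
    unfolding Lgeq_def topology_generated_by_topspace by auto
  have sub: "toL x \<in> Lgeq_set" for x using range_toL by blast
  have "\<exists>p\<in>Lgeq_set. lex_less q p \<or> lex_less p q" if q: "q \<in> Lgeq_set" for q
  proof (cases "q = (omega1_zero, 0)")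
    case True
    then show ?thesis using lex_less_zero(1) sub by blast
  next
    case False
    then obtain x where x: "q = toL x" using range_toL q by blast
    obtain y where "x < y" using ex_greater_ll by blast
    then show ?thesis using x lex_less_toL sub by blast
  qed
  then show ?thesis unfolding top by blast
qed

lemma topspace_Lplus: "topspace Lplus = range toL"
  unfolding Lplus_def by (simp add: topspace_Lgeq range_toL Int_absorb1)

lemma continuous_map_toL: "continuous_map euclidean Lplus toL"
proof -
  have "continuous_map euclidean Lgeq toL"
    unfolding Lgeq_def
  proof (rule continuous_on_generated_topo)
    fix U assume "U \<in> (\<lambda>p. {q \<in> Lgeq_set. lex_less q p}) ` Lgeq_set \<union>
      (\<lambda>p. {q \<in> Lgeq_set. lex_less p q}) ` Lgeq_set"
    then obtain p where p: "p \<in> Lgeq_set"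
      "U = {q \<in> Lgeq_set. lex_less q p} \<or> U = {q \<in> Lgeq_set. lex_less p q}" by blast
    have sub: "toL x \<in> Lgeq_set" for x using range_toL by blast
    \<comment> \<open>The generators include rays that end at the removed origin; those pull back to
      the empty set or to the whole type.\<close>
    have "open (toL -` U)"
    proof (cases "p = (omega1_zero, 0)")
      case True
      then have "toL -` U = {} \<or> toL -` U = UNIV"
        using p(2) sub lex_less_zero by (elim disjE) (simp_all add: vimage_def)
      then show ?thesis by auto
    next
      case False
      then obtain x where "p = toL x" using range_toL p(1) by blast
      then have "toL -` U = {..<x} \<or> toL -` U = {x<..}"
        using p(2) sub lex_less_toL by (elim disjE) (simp_all add: vimage_def lessThan_def greaterThan_def)
      then show ?thesis by auto
    qed
    then show "openin euclidean (toL -` U \<inter> topspace euclidean)" by simp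
  next
    show "toL ` topspace euclidean \<subseteq> \<Union> ((\<lambda>p. {q \<in> Lgeq_set. lex_less q p}) ` Lgeq_set \<union>
      (\<lambda>p. {q \<in> Lgeq_set. lex_less p q}) ` Lgeq_set)"
      using topspace_Lgeq range_toL unfolding Lgeq_def topology_generated_by_topspace by auto
  qed
  then show ?thesis
    unfolding Lplus_def continuous_map_in_subtopology using range_toL by auto
qed

lemma openin_Lplus_toL:
  assumes "open W"
  shows "openin Lplus (toL ` W)"
proof -
  have "generate_topology (range (\<lambda>a. {..<a}) \<union> range (\<lambda>a. {a<..})) W"
    using assms unfolding open_ll_def .
  then show ?thesis
  proof (induction rule: generate_topology.induct)
    case UNIV
    show ?case using openin_topspace[of Lplus] topspace_Lplus by simp
  next
    case (Int A B)
    then show ?case by (simp add: image_Int[OF inj_toL] openin_Int)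
  next
    case (UN K)
    then show ?case by (simp add: image_Union) (auto intro!: openin_Union)
  next
    case (Basis s)
    then obtain a where s: "s = {..<a} \<or> s = {a<..}" by blast
    let ?A = "{q \<in> Lgeq_set. lex_less q (toL a)}" and ?B = "{q \<in> Lgeq_set. lex_less (toL a) q}"
    have a: "toL a \<in> Lgeq_set" using range_toL by blast
    have "openin Lgeq ?A" "openin Lgeq ?B"
      unfolding Lgeq_def using a by (auto intro!: topology_generated_by_Basis)
    moreover have "toL ` {..<a} = ?A \<inter> range toL" "toL ` {a<..} = ?B \<inter> range toL"
    proof -
      have "toL ` {x. Q (toL x)} = {q \<in> Lgeq_set. Q q} \<inter> range toL" for Q
        using range_toL by blast
      from this[of "\<lambda>q. lex_less q (toL a)"] this[of "lex_less (toL a)"]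
      show "toL ` {..<a} = ?A \<inter> range toL" "toL ` {a<..} = ?B \<inter> range toL"
        by (simp_all only: lex_less_toL lessThan_def greaterThan_def)
    qed
    ultimately show ?case
      using s openin_subtopology_Int unfolding Lplus_def range_toL[symmetric] by fastforce
  qed
qed

lemma homeomorphic_maps_toL: "homeomorphic_maps euclidean Lplus toL fromL"
  unfolding homeomorphic_maps_def
proof (intro conjI ballI)
  show "continuous_map Lplus euclidean fromL"
    unfolding continuous_map_def
  proof (intro conjI allI impI)
    fix W :: "ll set" assume "openin euclidean W"
    moreover have "{x \<in> topspace Lplus. fromL x \<in> W} = toL ` W"
      unfolding topspace_Lplus by auto
    ultimately show "openin Lplus {x \<in> topspace Lplus. fromL x \<in> W}"
      using openin_Lplus_toL by simp
  qed simp
qed (auto simp: continuous_map_toL topspace_Lplus)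

section \<open>Coherent charts of initial segments\<close>

text \<open>The transition map of two coordinates, phrased without a topology on \<open>X\<close>;
  the openness inside \<open>smooth_inc\<close> makes the image of \<open>X\<close> under
  \<open>\<phi>\<close> open.\<close>

definition smooth_rel :: "'a set \<Rightarrow> ('a \<Rightarrow> real) \<Rightarrow> ('a \<Rightarrow> real) \<Rightarrow> bool" where
  "smooth_rel X \<phi> \<psi> \<longleftrightarrow> (\<exists>u. smooth_inc (\<phi> ` X) u \<and> (\<forall>x\<in>X. \<psi> x = u (\<phi> x)))"

lemma smooth_rel_refl: "open (\<phi> ` X) \<Longrightarrow> smooth_rel X \<phi> \<phi>"
  unfolding smooth_rel_def
  by (intro exI[of _ "\<lambda>x. x"] conjI smooth_incI[where u' = "\<lambda>_. 1"] Ck_const) auto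

lemma smooth_rel_trans:
  assumes "smooth_rel X \<phi> \<psi>" "smooth_rel X \<psi> \<theta>"
  shows "smooth_rel X \<phi> \<theta>"
proof -
  obtain u v where u: "smooth_inc (\<phi> ` X) u" "\<forall>x\<in>X. \<psi> x = u (\<phi> x)"
    and v: "smooth_inc (\<psi> ` X) v" "\<forall>x\<in>X. \<theta> x = v (\<psi> x)"
    using assms unfolding smooth_rel_def by blast
  have "u ` \<phi> ` X \<subseteq> \<psi> ` X" using u(2) by auto
  from smooth_inc_compose[OF u(1) v(1) this] show ?thesis
    unfolding smooth_rel_def using u(2) v(2) by (intro exI[of _ "\<lambda>x. v (u x)"]) simp
qed

lemma smooth_rel_subset:
  "smooth_rel X \<phi> \<psi> \<Longrightarrow> Y \<subseteq> X \<Longrightarrow> open (\<phi> ` Y) \<Longrightarrow> smooth_rel Y \<phi> \<psi>"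
  unfolding smooth_rel_def by (meson image_mono smooth_inc_subset subsetD)

lemma smooth_rel_cong:
  "smooth_rel X \<phi> \<psi> \<Longrightarrow> (\<And>x. x \<in> X \<Longrightarrow> \<psi> x = \<theta> x) \<Longrightarrow> smooth_rel X \<phi> \<theta>"
  unfolding smooth_rel_def by metis

lemma smooth_rel_open_image:
  assumes "smooth_rel X \<phi> \<psi>" "inj_on \<psi> X" "Y \<subseteq> X" "open (\<phi> ` Y)"
  shows "open (\<psi> ` Y)"
proof -
  obtain u where u: "smooth_inc (\<phi> ` X) u" "\<forall>x\<in>X. \<psi> x = u (\<phi> x)"
    using assms(1) unfolding smooth_rel_def by blast
  have "inj_on u (\<phi> ` X)" using assms(2) u(2) by (auto simp: inj_on_def)
  then have "open (u ` \<phi> ` Y)" using assms(3,4) by (intro smooth_inc_open_image[OF u(1)]) auto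
  moreover have "u ` \<phi> ` Y = \<psi> ` Y" using u(2) assms(3) by (force simp: image_image)
  ultimately show ?thesis by simp
qed

lemma smooth_rel_sym:
  assumes "smooth_rel X \<phi> \<psi>" "inj_on \<psi> X"
  shows "smooth_rel X \<psi> \<phi>"
proof -
  obtain u where u: "smooth_inc (\<phi> ` X) u" "\<forall>x\<in>X. \<psi> x = u (\<phi> x)"
    using assms(1) unfolding smooth_rel_def by blast
  have inj: "inj_on u (\<phi> ` X)" using assms(2) u(2) by (auto simp: inj_on_def)
  have "u ` \<phi> ` X = \<psi> ` X" using u(2) by (force simp: image_image)
  then show ?thesis
    unfolding smooth_rel_def using smooth_inc_inverse[OF u(1) inj] u(2) inv_into_f_f[OF inj]
    by (metis imageI)
qed

text \<open>Injectivity of \<open>\<phi>\<close> makes \<open>\<psi>\<close> a well-defined function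
  of \<open>\<phi>\<close> on all of \<open>X\<close>, so the local transition functions
  glue.\<close>

lemma smooth_rel_local:
  assumes "inj_on \<phi> X" "\<And>x. x \<in> X \<Longrightarrow> \<exists>Y\<subseteq>X. x \<in> Y \<and> smooth_rel Y \<phi> \<psi>"
  shows "smooth_rel X \<phi> \<psi>"
proof -
  define u where "u s = \<psi> (inv_into X \<phi> s)" for s
  have u: "u (\<phi> x) = \<psi> x" if "x \<in> X" for x using assms(1) that by (simp add: u_def)
  have "smooth_inc (\<phi> ` X) u"
  proof (rule smooth_inc_local)
    fix s assume "s \<in> \<phi> ` X"
    then obtain x where x: "x \<in> X" "s = \<phi> x" by blast
    obtain Y where Y: "Y \<subseteq> X" "x \<in> Y" "smooth_rel Y \<phi> \<psi>" using assms(2)[OF x(1)] by blast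
    obtain v where v: "smooth_inc (\<phi> ` Y) v" "\<forall>x\<in>Y. \<psi> x = v (\<phi> x)"
      using Y(3) unfolding smooth_rel_def by blast
    have "smooth_inc (\<phi> ` Y) u"
      by (rule smooth_inc_cong[OF v(1)]) (use v(2) u Y(1) in force)
    then show "\<exists>J. s \<in> J \<and> J \<subseteq> \<phi> ` X \<and> smooth_inc J u"
      using Y(1,2) x(2) by (intro exI[of _ "\<phi> ` Y"]) auto
  qed
  then show ?thesis unfolding smooth_rel_def using u by auto
qed

section \<open>Charts of initial segments and their extension past all earlier blocks\<close>

abbreviation (input) upto_blk :: "om \<Rightarrow> ll set" where "upto_blk a \<equiv> {x. blk x \<le> a}"
abbreviation (input) below_blk :: "om \<Rightarrow> ll set" where "below_blk a \<equiv> {x. blk x < a}"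

text \<open>In an order topology, monotonicity together with an open interval as image already makes
  \<open>g\<close> a homeomorphism onto that image.\<close>

definition initial_chart :: "om \<Rightarrow> (ll \<Rightarrow> real) \<Rightarrow> bool" where
  "initial_chart a g \<longleftrightarrow> strict_mono_on (upto_blk a) g \<and> open (g ` upto_blk a) \<and> is_interval (g ` upto_blk a)"

lemma initial_chart_inj: "initial_chart a g \<Longrightarrow> inj_on g (upto_blk a)"
  unfolding initial_chart_def using strict_mono_on_imp_inj_on by blast

lemma initial_chart_open:
  assumes "initial_chart a g"
  shows "open (g ` (upto_blk a \<inter> {..<z}))"
proof (cases "blk z \<le> a")
  case True
  have "g ` (upto_blk a \<inter> {..<z}) = g ` upto_blk a \<inter> {..<g z}"
  proof (intro set_eqI iffI)
    fix s assume "s \<in> g ` upto_blk a \<inter> {..<g z}"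
    then obtain x where "x \<in> upto_blk a" "s = g x" "g x < g z" by auto
    then show "s \<in> g ` (upto_blk a \<inter> {..<z})"
      using assms True strict_mono_on_less[of "upto_blk a" g x z] unfolding initial_chart_def by auto
  qed (use assms True strict_mono_onD[of "upto_blk a" g] in \<open>auto simp: initial_chart_def\<close>)
  then show ?thesis using assms by (simp add: initial_chart_def open_Int)
next
  case False
  then have "upto_blk a \<inter> {..<z} = upto_blk a" by (auto simp: less_ll_def)
  then show ?thesis using assms by (simp add: initial_chart_def)
qed

text \<open>Successor and limit blocks are treated alike: the countable set of rational points below
  \<open>a\<close> is enumerated by \<open>e\<close>, and each member of the sequence is chosen past
  its predecessor and past \<open>e n\<close>.\<close>

lemma cofinal_sequence:
  assumes "a \<noteq> om_zero"
  obtains p :: "nat \<Rightarrow> ll" where "strict_mono p" "\<And>n. blk (p n) < a" "\<And>x. blk x < a \<Longrightarrow> \<exists>n. x < p n"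
proof -
  let ?R = "rat_points \<inter> below_blk a"
  have up: "\<exists>z\<in>?R. x < z" if "blk x < a" for x
  proof -
    obtain y where "x < y" "blk y = blk x" using ex_greater_ll by blast
    moreover then obtain z where "z \<in> rat_points" "x < z" "z < y" using rat_points_dense by blast
    ultimately show ?thesis using that blk_mono[of z y] less_imp_le[of z y] by (intro bexI[of _ z]) auto
  qed
  obtain x0 where "blk x0 = om_zero" "off x0 = 1/2" using ex_ll[of "1/2" om_zero] by auto
  then have x0: "blk x0 < a" using assms om_zero_less_iff by simp
  then have "?R \<noteq> {}" using up by blast
  moreover have "countable ?R"
    by (rule countable_subset[OF _ countable_rat_points[of a]]) auto
  ultimately obtain e :: "nat \<Rightarrow> ll" where e: "range e = ?R"
    using uncountable_def by metis
  have "\<exists>p. \<forall>n. (blk (p n) < a \<and> e n < p n) \<and> p n < p (Suc n)"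
  proof (rule dependent_nat_choice)
    show "\<exists>x. blk x < a \<and> e 0 < x"
      using up[of "e 0"] e by blast
    fix x n assume "blk x < a \<and> e n < x"
    moreover have "blk (e (Suc n)) < a" using e by blast
    ultimately have "blk (max x (e (Suc n))) < a" by (simp add: max_def)
    then obtain z where "z \<in> ?R" "max x (e (Suc n)) < z" using up by blast
    then show "\<exists>y. (blk y < a \<and> e (Suc n) < y) \<and> x < y" by auto
  qed
  then obtain p where p: "\<And>n. blk (p n) < a" "\<And>n. e n < p n" "\<And>n. p n < p (Suc n)" by blast
  show ?thesis
  proof
    show "strict_mono p" using p(3) by (rule strict_mono_Suc_iff[THEN iffD2, rule_format])
    show "\<exists>n. x < p n" if x: "blk x < a" for x
    proof -
      obtain z where "z \<in> ?R" "x < z" using up[OF x] by blast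
      moreover then obtain n where "z = e n" using e by blast
      ultimately show ?thesis using p(2) less_trans by blast
    qed
  qed (rule p(1))
qed

text \<open>The given charts are compatible, but their values at the points \<open>p n\<close> are
  uncontrolled. Functions \<open>h n\<close>, compatible with the chart at the block of
  \<open>p n\<close>, are built with \<open>h n (p n) = y n\<close>, and \<open>h (Suc n)\<close>
  agrees with \<open>h n\<close> up to \<open>p n\<close>; beyond that point it is bent by
  \<open>smooth_inc_extend\<close> to meet the next prescribed value. The union of the stable parts
  is the required coordinate below \<open>a\<close>.\<close>

lemma initial_chart_limit:
  fixes G :: "om \<Rightarrow> ll \<Rightarrow> real" and y :: "nat \<Rightarrow> real"
  assumes p: "strict_mono p" "\<And>n. blk (p n) < a" "\<And>x. blk x < a \<Longrightarrow> \<exists>n. x < p n"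
    and y: "strict_mono y" "\<And>n. y n < 0"
    and G: "\<And>b. b < a \<Longrightarrow> initial_chart b (G b)"
    and rel: "\<And>b c. b \<le> c \<Longrightarrow> c < a \<Longrightarrow> smooth_rel (upto_blk b) (G b) (G c)"
  obtains \<phi> where "strict_mono_on (below_blk a) \<phi>" "open (\<phi> ` below_blk a)" "is_interval (\<phi> ` below_blk a)"
    "\<And>x. blk x < a \<Longrightarrow> \<phi> x < 0" "\<And>n. \<phi> (p n) = y n"
    "\<And>b. b < a \<Longrightarrow> smooth_rel (upto_blk b) (G b) \<phi>"
proof -
  let ?B = "\<lambda>n. blk (p n)" and ?E = "\<lambda>n. upto_blk (blk (p n))"
  have pp: "p n < p m" if "n < m" for n m using p(1) that by (simp add: strict_mono_less)
  have B: "?B n \<le> ?B m" if "n \<le> m" for n m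
    using p(1) that by (intro blk_mono) (simp add: strict_mono_less_eq)
  have inj: "inj_on (G c) (upto_blk b)" if "b \<le> c" "c < a" for b c
    by (rule inj_on_subset[OF initial_chart_inj[OF G[OF that(2)]]]) (use that in auto)
  let ?Q = "\<lambda>n h. smooth_rel (?E n) (G (?B n)) h \<and> h (p n) = y n"
  have "\<exists>h. \<forall>n. ?Q n (h n) \<and> (\<forall>x\<le>p n. h (Suc n) x = h n x)"
  proof (rule dependent_nat_choice)
    define k where "k = y 0 - G (?B 0) (p 0)"
    have "open (G (?B 0) ` ?E 0)" using G[OF p(2)] unfolding initial_chart_def by blast
    then have "smooth_inc (G (?B 0) ` ?E 0) (\<lambda>s. s + k)"
      by (intro smooth_incI[where u' = "\<lambda>_. 1"] Ck_const) (auto intro!: derivative_eq_intros)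
    then have "?Q 0 (\<lambda>x. G (?B 0) x + k)" unfolding smooth_rel_def by (auto simp: k_def)
    then show "\<exists>h. ?Q 0 h" by blast
  next
    fix h n assume Q: "?Q n h"
    let ?g = "G (?B (Suc n))" and ?E' = "?E (Suc n)"
    have le: "?B n \<le> ?B (Suc n)" and lt: "?B (Suc n) < a" using B p(2) by auto
    have sub: "?E n \<subseteq> ?E'" using le by auto
    have chart: "initial_chart (?B (Suc n)) ?g" by (rule G[OF lt])
    \<comment> \<open>The current stage is rewritten in the larger coordinate \<open>?g\<close>.
      There it becomes a smooth increasing \<open>u\<close> on an initial part of the interval, the
      form that \<open>smooth_inc_extend\<close> needs.\<close>
    have "smooth_rel (?E n) ?g h"
      using smooth_rel_trans[OF smooth_rel_sym[OF rel[OF le lt] inj[OF le lt]]] Q by blast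
    then obtain u where u: "smooth_inc (?g ` ?E n) u" "\<forall>x\<in>?E n. h x = u (?g x)"
      unfolding smooth_rel_def by blast
    have mono: "?g x < ?g z \<longleftrightarrow> x < z" if "x \<in> ?E'" "z \<in> ?E'" for x z
      using chart that unfolding initial_chart_def by (metis strict_mono_on_less)
    have pE: "p n \<in> ?E n" "p n \<in> ?E'" "p (Suc n) \<in> ?E'" using le by auto
    have low: "s \<in> ?g ` ?E n" if "s \<in> ?g ` ?E'" "s \<le> ?g (p n)" for s
    proof -
      obtain x where x: "x \<in> ?E'" "s = ?g x" using \<open>s \<in> ?g ` ?E'\<close> by blast
      then have "x \<le> p n" using mono[OF pE(2) x(1)] that(2) by (simp add: not_less[symmetric])
      then show ?thesis using x blk_mono by auto
    qed
    have "?g (p n) < ?g (p (Suc n))" using mono[OF pE(2,3)] pp by simp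
    moreover have "u (?g (p n)) < y (Suc n)"
      using u(2) pE(1) Q y(1) by (metis lessI strict_mono_less)
    ultimately obtain v where v: "smooth_inc (?g ` ?E') v"
      "\<And>s. s \<in> ?g ` ?E' \<Longrightarrow> s \<le> ?g (p n) \<Longrightarrow> v s = u s" "v (?g (p (Suc n))) = y (Suc n)"
      using smooth_inc_extend[OF u(1) _ _ low, where q = "?g (p (Suc n))" and y = "y (Suc n)"] chart pE sub
      unfolding initial_chart_def by (smt (verit) image_eqI image_mono)
    have "?Q (Suc n) (\<lambda>x. v (?g x))" unfolding smooth_rel_def using v(1,3) by blast
    moreover have "v (?g x) = h x" if "x \<le> p n" for x
    proof -
      have x: "x \<in> ?E n" using that blk_mono by auto
      then have "?g x \<le> ?g (p n)" using mono[of "p n" x] sub pE that by (metis not_le subsetD)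
      then show ?thesis using v(2) u(2) x sub by auto
    qed
    ultimately show "\<exists>h'. ?Q (Suc n) h' \<and> (\<forall>x\<le>p n. h' x = h x)" by blast
  qed
  then obtain h where h: "\<And>n. smooth_rel (?E n) (G (?B n)) (h n)" "\<And>n. h n (p n) = y n"
    "\<And>n x. x \<le> p n \<Longrightarrow> h (Suc n) x = h n x" by blast
  have h_mono: "strict_mono_on (?E n) (h n)" for n
  proof -
    obtain u where u: "smooth_inc (G (?B n) ` ?E n) u" "\<forall>x\<in>?E n. h n x = u (G (?B n) x)"
      using h(1) unfolding smooth_rel_def by blast
    have g: "initial_chart (?B n) (G (?B n))" by (rule G[OF p(2)])
    then have "strict_mono_on (G (?B n) ` ?E n) u"
      using smooth_inc_strict_mono[OF u(1)] unfolding initial_chart_def by blast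
    then show ?thesis using u(2) g unfolding initial_chart_def strict_mono_on_def by auto
  qed
  have h_eq: "h m x = h n x" if "x \<le> p n" "n \<le> m" for n m x
    using that(2)
  proof (induction m rule: dec_induct)
    case (step m)
    have "x \<le> p m" using that(1) step(1) p(1) by (metis order_trans strict_mono_less_eq)
    then show ?case using h(3) step by metis
  qed simp
  \<comment> \<open>The least stage that reaches \<open>x\<close> is a definite choice; by
    \<open>h_eq\<close> all later stages give the same value.\<close>
  define \<phi> where "\<phi> x = h (LEAST n. x \<le> p n) x" for x
  have \<phi>: "\<phi> x = h n x" if "x \<le> p n" for x n
    unfolding \<phi>_def
    using h_eq[of x "LEAST n. x \<le> p n" n] LeastI[of "\<lambda>n. x \<le> p n" n] Least_le[of "\<lambda>n. x \<le> p n" n] that by simp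
  have \<phi>_mono: "strict_mono_on (below_blk a) \<phi>"
  proof (rule strict_mono_onI)
    fix x z assume xz: "x \<in> below_blk a" "z \<in> below_blk a" "x < z"
    then obtain n where n: "z < p n" using p(3) by blast
    then have le: "x \<le> p n" "z \<le> p n" using xz(3) by auto
    then have "x \<in> ?E n" "z \<in> ?E n" using blk_mono by auto
    from strict_mono_onD[OF h_mono this xz(3)] show "\<phi> x < \<phi> z"
      using \<phi>[OF le(1)] \<phi>[OF le(2)] by simp
  qed
  then have \<phi>_inj: "inj_on \<phi> (below_blk a)" by (rule strict_mono_on_imp_inj_on)
  have \<phi>_rel: "smooth_rel (upto_blk b) (G b) \<phi>" if b: "b < a" for b
  proof (rule smooth_rel_local)
    show "inj_on (G b) (upto_blk b)" by (rule inj[OF order_refl b])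
    fix x assume x: "x \<in> upto_blk b"
    then obtain n where n: "x < p n" using p(3) b by (metis mem_Collect_eq order.strict_trans1)
    \<comment> \<open>\<open>b\<close> and the block of \<open>p n\<close> may come in either order,
      so both charts are compared through the one at their maximum; cutting at \<open>p n\<close>
      makes \<open>\<phi>\<close> equal to the single stage \<open>h n\<close>.\<close>
    let ?Y = "upto_blk b \<inter> {..<p n}" and ?c = "max b (?B n)"
    have c: "b \<le> ?c" "?B n \<le> ?c" "?c < a" using b p(2) by auto
    have YE: "?Y \<subseteq> ?E n" by (auto intro: blk_mono less_imp_le)
    have 0: "open (G b ` ?Y)" by (rule initial_chart_open[OF G[OF b]])
    have 1: "smooth_rel ?Y (G b) (G ?c)"
      by (rule smooth_rel_subset[OF rel[OF c(1,3)] _ 0]) auto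
    have "open (G ?c ` ?Y)"
      by (rule smooth_rel_open_image[OF 1 _ order_refl 0]) (rule inj_on_subset[OF inj[OF c(1,3)]], auto)
    from smooth_rel_subset[OF smooth_rel_sym[OF rel[OF c(2,3)] inj[OF c(2,3)]] YE this]
    have 2: "smooth_rel ?Y (G b) (G (?B n))" by (rule smooth_rel_trans[OF 1])
    have "open (G (?B n) ` ?Y)"
      by (rule smooth_rel_open_image[OF 2 _ order_refl 0])
        (rule inj_on_subset[OF inj[OF order_refl p(2)] YE])
    from smooth_rel_trans[OF 2 smooth_rel_subset[OF h(1) YE this]]
    have "smooth_rel ?Y (G b) (h n)" .
    then have "smooth_rel ?Y (G b) \<phi>" by (rule smooth_rel_cong) (rule \<phi>[symmetric], simp add: less_imp_le)
    then show "\<exists>Y\<subseteq>upto_blk b. x \<in> Y \<and> smooth_rel Y (G b) \<phi>"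
      using x n by (intro exI[of _ ?Y]) auto
  qed
  have op: "open (\<phi> ` upto_blk b)" and conn: "is_interval (\<phi> ` upto_blk b)" if b: "b < a" for b
  proof -
    have g: "open (G b ` upto_blk b)" "is_interval (G b ` upto_blk b)"
      using G[OF b] unfolding initial_chart_def by auto
    show "open (\<phi> ` upto_blk b)"
      by (rule smooth_rel_open_image[OF \<phi>_rel[OF b] _ order_refl g(1)], rule inj_on_subset[OF \<phi>_inj])
        (use b in auto)
    obtain u where u: "smooth_inc (G b ` upto_blk b) u" "\<forall>x\<in>upto_blk b. \<phi> x = u (G b x)"
      using \<phi>_rel[OF b] unfolding smooth_rel_def by blast
    have "connected (u ` G b ` upto_blk b)"
      by (rule connected_continuous_image[OF smooth_incD(6)[OF u(1)] is_interval_connected[OF g(2)]])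
    moreover have "u ` G b ` upto_blk b = \<phi> ` upto_blk b" using u(2) by (force simp: image_image)
    ultimately show "is_interval (\<phi> ` upto_blk b)" by (simp add: is_interval_connected_1)
  qed
  have un: "\<phi> ` below_blk a = (\<Union>b\<in>{..<a}. \<phi> ` upto_blk b)" by force
  show ?thesis
  proof
    show "open (\<phi> ` below_blk a)" unfolding un using op by blast
    show "is_interval (\<phi> ` below_blk a)"
      unfolding is_interval_1
    proof (intro ballI allI impI)
      fix s t r assume "s \<in> \<phi> ` below_blk a" "t \<in> \<phi> ` below_blk a" and r: "s \<le> r \<and> r \<le> t"
      then obtain x z where xz: "blk x < a" "blk z < a" "s = \<phi> x" "t = \<phi> z" by blast
      let ?b = "max (blk x) (blk z)"
      have "s \<in> \<phi> ` upto_blk ?b" "t \<in> \<phi> ` upto_blk ?b" using xz by auto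
      then have "r \<in> \<phi> ` upto_blk ?b" using conn[of ?b] xz r mem_is_interval_1_I[of _ s t r] by auto
      moreover have "?b < a" using xz(1,2) by simp
      moreover then have "upto_blk ?b \<subseteq> below_blk a" using le_less_trans by blast
      ultimately show "r \<in> \<phi> ` below_blk a" by blast
    qed
    show "\<phi> (p n) = y n" for n using \<phi>[of "p n" n] h(2) by simp
    show "\<phi> x < 0" if x: "blk x < a" for x
    proof -
      obtain n where "x < p n" using p(3)[OF x] by blast
      then have "\<phi> x < \<phi> (p n)" using \<phi>_mono strict_mono_onD x p(2) by blast
      then show ?thesis using \<phi>[of "p n" n] h(2)[of n] y(2)[of n] by simp
    qed
  qed (use \<phi>_mono \<phi>_rel in auto)
qed


text \<open>Chosen independently of exponents and charts, so that the rates of two different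
  structures at a corner are measured along the same points.\<close>

definition cofinal_seq :: "om \<Rightarrow> nat \<Rightarrow> ll" where
  "cofinal_seq a = (SOME p. strict_mono p \<and> (\<forall>n. blk (p n) < a) \<and> (\<forall>x. blk x < a \<longrightarrow> (\<exists>n. x < p n)))"

lemma cofinal_seq:
  assumes "a \<noteq> om_zero"
  shows "strict_mono (cofinal_seq a)" "blk (cofinal_seq a n) < a" "blk x < a \<Longrightarrow> \<exists>n. x < cofinal_seq a n"
proof -
  have "\<exists>p :: nat \<Rightarrow> ll. strict_mono p \<and> (\<forall>n. blk (p n) < a) \<and> (\<forall>x. blk x < a \<longrightarrow> (\<exists>n. x < p n))"
  proof (rule cofinal_sequence[OF assms])
    fix p :: "nat \<Rightarrow> ll"
    assume "strict_mono p" "\<And>n. blk (p n) < a" "\<And>x. blk x < a \<Longrightarrow> \<exists>n. x < p n"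
    then show ?thesis by (intro exI[of _ p]) simp
  qed
  from someI_ex[OF this, folded cofinal_seq_def]
  show "strict_mono (cofinal_seq a)" "blk (cofinal_seq a n) < a" "blk x < a \<Longrightarrow> \<exists>n. x < cofinal_seq a n"
    by blast+
qed

text \<open>Points below a corner receive negative coordinates and the corner receives
  \<open>0\<close>, hence the sign. The exponent \<open>exp t\<close> makes every real parameter
  admissible and keeps distinct parameters distinct; \<open>Suc n\<close> avoids the base
  \<open>0\<close>.\<close>

definition decay :: "real \<Rightarrow> nat \<Rightarrow> real" where
  "decay t n = - (real (Suc n) powr - exp t)"

lemma decay_neg: "decay t n < 0"
  by (simp add: decay_def)

lemma decay_strict_mono: "strict_mono (decay t)"
  unfolding strict_mono_Suc_iff decay_def
  by (auto intro!: powr_less_mono2_neg)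

lemma decay_tendsto_0: "decay t \<longlonglongrightarrow> 0"
proof -
  have "(\<lambda>n. real (Suc n) powr - exp t) \<longlonglongrightarrow> 0"
    by (rule tendsto_neg_powr) (simp, rule filterlim_compose[OF filterlim_real_sequentially filterlim_Suc])
  then show ?thesis unfolding decay_def using tendsto_minus by fastforce
qed

text \<open>Transfinite recursion on the block. The chart at \<open>a\<close> must match all earlier
  charts, but none of these contains the corner of \<open>a\<close>, so the rate of approach to that
  corner is free.\<close>

lemma chart_family:
  fixes t :: "om \<Rightarrow> real"
  obtains G :: "om \<Rightarrow> ll \<Rightarrow> real" where
    "\<And>a. initial_chart a (G a)"
    "\<And>a b. a \<le> b \<Longrightarrow> smooth_rel (upto_blk a) (G a) (G b)"
    "\<And>a x. blk x = a \<Longrightarrow> G a x = off x"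
    "\<And>a n. a \<noteq> om_zero \<Longrightarrow> G a (cofinal_seq a n) = decay (t a) n"
proof -
  let ?P = "\<lambda>(G :: om \<Rightarrow> ll \<Rightarrow> real) a g. initial_chart a g \<and> (\<forall>b<a. smooth_rel (upto_blk b) (G b) g) \<and>
    (\<forall>x. blk x = a \<longrightarrow> g x = off x) \<and> (a \<noteq> om_zero \<longrightarrow> (\<forall>n. g (cofinal_seq a n) = decay (t a) n))"
  have "\<exists>G. \<forall>a. ?P G a (G a)"
  proof (rule dependent_wf_choice[of "{(x, y). x < y}"])
    show "wf {(x, y). x < (y::om)}" by (rule wf)
  next
    fix G H :: "om \<Rightarrow> ll \<Rightarrow> real" and a g
    assume "\<And>b. (b, a) \<in> {(x, y). x < y} \<Longrightarrow> G b = H b"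
    then show "?P G a g = ?P H a g" by simp
  next
    fix a and G :: "om \<Rightarrow> ll \<Rightarrow> real"
    assume "\<And>b. (b, a) \<in> {(x, y). x < y} \<Longrightarrow> ?P G b (G b)"
    then have IH: "?P G b (G b)" if "b < a" for b using that by simp
    have rel: "smooth_rel (upto_blk b) (G b) (G c)" if "b \<le> c" "c < a" for b c
    proof (cases "b = c")
      case True
      then show ?thesis using IH[OF that(2)] smooth_rel_refl unfolding initial_chart_def by blast
    qed (use IH[OF that(2)] that in auto)
    show "\<exists>g. ?P G a g"
    proof (cases "a = om_zero")
      case True
      have blk0: "blk x \<le> om_zero \<longleftrightarrow> blk x = om_zero" for x by (simp add: antisym)
      have "off ` upto_blk a = {0<..<1}"
      proof (intro set_eqI iffI)
        fix s :: real assume "s \<in> {0<..<1}"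
        then obtain x where "blk x = om_zero" "off x = s" using ex_ll[of s om_zero] by auto
        then show "s \<in> off ` upto_blk a" using True by auto
      qed (use off_bounds True blk0 in auto)
      moreover have "strict_mono_on (upto_blk a) off"
        using True blk0 by (auto intro!: strict_mono_onI simp: less_ll_def)
      ultimately have "initial_chart a off" unfolding initial_chart_def by (simp add: is_interval_oo)
      moreover have "\<not> b < om_zero" for b by (simp add: not_less)
      ultimately have "?P G a off" using True by blast
      then show ?thesis by blast
    next
      case False
      note p = cofinal_seq[OF False]
      obtain \<phi> where \<phi>: "strict_mono_on (below_blk a) \<phi>" "open (\<phi> ` below_blk a)" "is_interval (\<phi> ` below_blk a)"
        "\<And>x. blk x < a \<Longrightarrow> \<phi> x < 0" "\<And>n. \<phi> (cofinal_seq a n) = decay (t a) n"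
        "\<And>b. b < a \<Longrightarrow> smooth_rel (upto_blk b) (G b) \<phi>"
      proof (rule initial_chart_limit[OF p decay_strict_mono decay_neg])
        show "initial_chart b (G b)" if "b < a" for b using IH[OF that] by blast
      qed (use rel in blast)+
      \<comment> \<open>No regularity is demanded across the corner: \<open>g\<close> itself is what
        defines the structure there.\<close>
      define g where "g x = (if blk x < a then \<phi> x else off x)" for x
      have "strict_mono_on (upto_blk a) g"
      proof (rule strict_mono_onI)
        fix x z assume xz: "x \<in> upto_blk a" "z \<in> upto_blk a" "x < z"
        show "g x < g z"
        proof (cases "blk z < a")
          case True
          moreover have "blk x \<le> blk z" using xz(3) blk_mono less_imp_le by blast
          ultimately show ?thesis using strict_mono_onD[OF \<phi>(1), of x z] xz(3) by (auto simp: g_def)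
        next
          case False
          then show ?thesis using xz \<phi>(4)[of x] off_bounds(1)[of z] by (auto simp: g_def less_ll_def)
        qed
      qed
      \<comment> \<open>The second interval overlaps the first instead of starting at
        \<open>0\<close>, which makes openness and connectedness of the union visible. Its negative
        part is already covered because the prescribed values tend to \<open>0\<close>.\<close>
      moreover have im: "g ` upto_blk a = \<phi> ` below_blk a \<union> {decay (t a) 0<..<1}"
      proof (intro set_eqI iffI)
        fix s assume "s \<in> g ` upto_blk a"
        then obtain x where "x \<in> upto_blk a" "s = g x" by blast
        then show "s \<in> \<phi> ` below_blk a \<union> {decay (t a) 0<..<1}"
          using off_bounds[of x] decay_neg[of "t a" 0] by (auto simp: g_def)
      next
        fix s assume s: "s \<in> \<phi> ` below_blk a \<union> {decay (t a) 0<..<1}"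
        have 1: "\<phi> ` below_blk a \<subseteq> g ` upto_blk a" by (force simp: g_def)
        show "s \<in> g ` upto_blk a"
        proof (cases "s \<in> \<phi> ` below_blk a")
          case outside: False
          then have s: "decay (t a) 0 < s" "s < 1" using s by auto
          have "s \<ge> 0"
          proof (rule ccontr)
            assume "\<not> s \<ge> 0"
            then obtain n where "s < decay (t a) n"
              using order_tendstoD(1)[OF decay_tendsto_0, of s "t a"] by (auto simp: eventually_sequentially)
            then have "s \<in> \<phi> ` below_blk a"
              using mem_is_interval_1_I[OF \<phi>(3), of "decay (t a) 0" "decay (t a) n" s] s p(2) \<phi>(5)
              by (metis imageI less_imp_le mem_Collect_eq)
            then show False using outside by blast
          qed
          then obtain x where "blk x = a" "off x = s" using ex_ll[of s a] s False by auto
          then show ?thesis by (intro image_eqI[of _ _ x]) (auto simp: g_def)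
        qed (use 1 in blast)
      qed
      moreover have "open (g ` upto_blk a)" unfolding im using \<phi>(2) by auto
      moreover have "is_interval (g ` upto_blk a)"
      proof -
        \<comment> \<open>Index \<open>1\<close> serves as common point, since
          \<open>decay (t a) 0\<close> is the excluded endpoint of the second interval.\<close>
        have "decay (t a) (Suc 0) \<in> \<phi> ` below_blk a \<inter> {decay (t a) 0<..<1}"
          using \<phi>(5)[of "Suc 0"] p(2) decay_neg[of "t a" "Suc 0"] decay_strict_mono[of "t a"]
          by (auto simp: strict_mono_Suc_iff intro!: image_eqI[of _ _ "cofinal_seq a (Suc 0)"])
        then have "connected (\<phi> ` below_blk a \<union> {decay (t a) 0<..<1})"
          using \<phi>(3) by (intro connected_Un) (auto simp: is_interval_connected_1[symmetric] is_interval_oo)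
        then show ?thesis unfolding im by (simp add: is_interval_connected_1)
      qed
      ultimately have "initial_chart a g" unfolding initial_chart_def by blast
      moreover have "smooth_rel (upto_blk b) (G b) g" if "b < a" for b
        by (rule smooth_rel_cong[OF \<phi>(6)[OF that]]) (use that in \<open>auto simp: g_def\<close>)
      ultimately have "?P G a g" using \<phi>(5) p(2) by (auto simp: g_def)
      then show ?thesis by blast
    qed
  qed
  then obtain G where G: "\<And>a. ?P G a (G a)" by blast
  show ?thesis
  proof
    show "smooth_rel (upto_blk a) (G a) (G b)" if "a \<le> b" for a b
    proof (cases "a = b")
      case True
      then show ?thesis using G[of a] smooth_rel_refl unfolding initial_chart_def by blast
    qed (use G[of b] that in auto)
  qed (use G in auto)
qed

section \<open>Atlases and products\<close>

lemma is_chartD: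
  assumes "is_chart X (U, \<phi>)"
  shows "openin X U" "open (\<phi> ` U)" "inj_on \<phi> U" "openin X W \<Longrightarrow> W \<subseteq> U \<Longrightarrow> open (\<phi> ` W)"
proof -
  show U: "openin X U" and op: "open (\<phi> ` U)"
    using assms unfolding is_chart_def by auto
  have hom: "homeomorphic_map (subtopology X U) (top_of_set (\<phi> ` U)) \<phi>"
    using assms unfolding is_chart_def by auto
  have top: "topspace (subtopology X U) = U" using openin_subset[OF U] by auto
  show "inj_on \<phi> U" using homeomorphic_imp_injective_map[OF hom] top by simp
  assume W: "openin X W" "W \<subseteq> U"
  then have "openin (subtopology X U) W" using openin_open_subtopology[OF U] by blast
  then have "openin (top_of_set (\<phi> ` U)) (\<phi> ` W)"
    using homeomorphic_imp_open_map[OF hom] unfolding open_map_def by blast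
  then show "open (\<phi> ` W)" using openin_open_trans op by blast
qed

lemma compatible_sym: "compatible r c d \<Longrightarrow> compatible r d c"
  unfolding compatible_def by (auto simp: Int_commute split: prod.splits)

text \<open>Near each point the transition factors through a third chart \<open>\<theta>\<close>
  compatible with both, and being of class \<open>C^k\<close> is a local property.\<close>

lemma transition_via:
  fixes \<phi> \<psi> :: "'x \<Rightarrow> 'e::euclidean_space"
  assumes c: "is_chart X (U, \<phi>)" and d: "is_chart X (V, \<psi>)"
    and via: "\<And>x. x \<in> U \<inter> V \<Longrightarrow> \<exists>W \<theta>. is_chart X (W, \<theta>) \<and> x \<in> W \<and>
      compatible r (W, \<theta>) (U, \<phi>) \<and> compatible r (W, \<theta>) (V, \<psi> :: 'x \<Rightarrow> 'e)"
  shows "Cr r (\<phi> ` (U \<inter> V)) (\<psi> \<circ> inv_into U \<phi>)"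
  unfolding Cr_def
proof (intro allI impI)
  fix k assume k: "enat k \<le> r"
  show "Ck k (\<phi> ` (U \<inter> V)) (\<psi> \<circ> inv_into U \<phi>)"
  proof (rule Ck_local)
    fix s assume "s \<in> \<phi> ` (U \<inter> V)"
    then obtain x where x: "x \<in> U \<inter> V" "s = \<phi> x" by blast
    obtain W \<theta> where W: "is_chart X (W, \<theta>)" "x \<in> W"
      "compatible r (W, \<theta>) (U, \<phi>)" "compatible r (W, \<theta>) (V, \<psi>)" using via[OF x(1)] by blast
    let ?Y = "U \<inter> V \<inter> W"
    have op: "open (\<phi> ` ?Y)"
      using is_chartD(1)[OF c] is_chartD(1)[OF d] is_chartD(1)[OF W(1)]
      by (intro is_chartD(4)[OF c]) auto
    have 1: "Ck k (\<phi> ` (W \<inter> U)) (\<theta> \<circ> inv_into U \<phi>)" "Ck k (\<theta> ` (W \<inter> V)) (\<psi> \<circ> inv_into W \<theta>)"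
      using W(3,4) k unfolding compatible_def Cr_def by auto
    have "Ck k (\<phi> ` ?Y) (\<lambda>s. (\<psi> \<circ> inv_into W \<theta>) ((\<theta> \<circ> inv_into U \<phi>) s))"
    proof (rule Ck_compose[OF op _ 1(2)])
      show "(\<theta> \<circ> inv_into U \<phi>) ` \<phi> ` ?Y \<subseteq> \<theta> ` (W \<inter> V)"
        using is_chartD(3)[OF c] by auto
      show "Ck k (\<phi> ` ?Y) (\<theta> \<circ> inv_into U \<phi>)" by (rule Ck_subset[OF 1(1)]) auto
    qed
    then have "Ck k (\<phi> ` ?Y) (\<psi> \<circ> inv_into U \<phi>)"
      by (rule Ck_cong_open[OF op, rotated])
        (use is_chartD(3)[OF c] is_chartD(3)[OF W(1)] in auto)
    then show "\<exists>Z. open Z \<and> s \<in> Z \<and> Ck k Z (\<psi> \<circ> inv_into U \<phi>)"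
      using op x W(2) by blast
  qed
qed

definition atlas :: "enat \<Rightarrow> 'x topology \<Rightarrow> ('x set \<times> ('x \<Rightarrow> 'e::euclidean_space)) set \<Rightarrow> bool" where
  "atlas r X A \<longleftrightarrow> (\<forall>c\<in>A. is_chart X c) \<and> \<Union>(fst ` A) = topspace X \<and> (\<forall>c\<in>A. \<forall>d\<in>A. compatible r c d)"

lemma atlasD:
  assumes "atlas r X A"
  shows "c \<in> A \<Longrightarrow> is_chart X c" "c \<in> A \<Longrightarrow> d \<in> A \<Longrightarrow> compatible r c d" "\<Union>(fst ` A) = topspace X"
  using assms by (simp_all add: atlas_def)

lemma diff_structure_atlas: "diff_structure r X A \<Longrightarrow> atlas r X A"
  unfolding diff_structure_def atlas_def by blast

lemma atlas_subset_max: "atlas r X A \<Longrightarrow> A \<subseteq> max_atlas r X A"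
  unfolding atlas_def max_atlas_def by blast

text \<open>Two charts compatible with \<open>A\<close> are compatible with each other by factoring
  through charts of \<open>A\<close>; maximality follows because \<open>A\<close> is contained in
  its completion.\<close>

lemma diff_structure_max_atlas:
  fixes A :: "('x set \<times> ('x \<Rightarrow> 'e::euclidean_space)) set"
  assumes A: "atlas r X A"
  shows "diff_structure r X (max_atlas r X A)"
  unfolding diff_structure_def
proof (intro conjI ballI allI impI)
  fix c d assume c: "c \<in> max_atlas r X A" and d: "d \<in> max_atlas r X A"
  obtain U \<phi> V \<psi> where e: "c = (U, \<phi>)" "d = (V, \<psi>)" by (metis surj_pair)
  have ch: "is_chart X (U, \<phi>)" "is_chart X (V, \<psi>)" using c d e unfolding max_atlas_def by auto
  have via: "\<exists>W \<theta>. is_chart X (W, \<theta>) \<and> x \<in> W \<and> compatible r (W, \<theta>) (U, \<phi>) \<and> compatible r (W, \<theta>) (V, \<psi>)"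
    if "x \<in> U" for x
  proof -
    have "x \<in> topspace X" using that openin_subset[OF is_chartD(1)[OF ch(1)]] by blast
    then have "x \<in> \<Union>(fst ` A)" using atlasD(3)[OF A] by simp
    then obtain W \<theta> where W: "(W, \<theta>) \<in> A" "x \<in> W" by force
    moreover have "compatible r (W, \<theta>) (U, \<phi>)" "compatible r (W, \<theta>) (V, \<psi>)"
      using W(1) c d e unfolding max_atlas_def by auto
    ultimately show ?thesis using atlasD(1)[OF A] by blast
  qed
  have "Cr r (\<phi> ` (U \<inter> V)) (\<psi> \<circ> inv_into U \<phi>)"
    by (rule transition_via[OF ch]) (use via in blast)
  moreover have "Cr r (\<psi> ` (V \<inter> U)) (\<phi> \<circ> inv_into V \<psi>)"
    by (rule transition_via[OF ch(2,1)]) (use via in blast)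
  ultimately show "compatible r c d" unfolding e compatible_def by (simp add: Int_commute)
next
  show "is_chart X c" if "c \<in> max_atlas r X A" for c using that unfolding max_atlas_def by blast
  show "\<Union> (fst ` max_atlas r X A) = topspace X"
  proof
    have "fst c \<subseteq> topspace X" if "c \<in> max_atlas r X A" for c
      using that is_chartD(1)[of X "fst c" "snd c"] openin_subset[of X "fst c"] unfolding max_atlas_def by simp
    then show "\<Union> (fst ` max_atlas r X A) \<subseteq> topspace X" by blast
    have "\<Union> (fst ` A) \<subseteq> \<Union> (fst ` max_atlas r X A)"
      using atlas_subset_max[OF A] by blast
    then show "topspace X \<subseteq> \<Union> (fst ` max_atlas r X A)" using atlasD(3)[OF A] by simp
  qed
  show "c \<in> max_atlas r X A" if "is_chart X c \<and> (\<forall>a\<in>max_atlas r X A. compatible r a c)" for c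
    using that atlas_subset_max[OF A] unfolding max_atlas_def by blast
qed

section \<open>Product charts\<close>

lemma is_chart_prod:
  assumes c: "is_chart X (U, \<phi>)" and d: "is_chart Y (V, \<psi>)"
  shows "is_chart (prod_topology X Y) (U \<times> V, \<lambda>(x, y). (\<phi> x, \<psi> y))"
proof -
  have im: "(\<lambda>(x, y). (\<phi> x, \<psi> y)) ` (U \<times> V) = \<phi> ` U \<times> \<psi> ` V" by auto
  obtain f g where "homeomorphic_maps (subtopology X U) (top_of_set (\<phi> ` U)) \<phi> f"
    "homeomorphic_maps (subtopology Y V) (top_of_set (\<psi> ` V)) \<psi> g"
    using c d unfolding is_chart_def homeomorphic_map_maps by auto
  then have "homeomorphic_maps (prod_topology (subtopology X U) (subtopology Y V))
      (prod_topology (top_of_set (\<phi> ` U)) (top_of_set (\<psi> ` V))) (\<lambda>(x, y). (\<phi> x, \<psi> y)) (\<lambda>(x, y). (f x, g y))"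
    unfolding homeomorphic_maps_prod by blast
  then have "homeomorphic_map (subtopology (prod_topology X Y) (U \<times> V))
      (top_of_set (\<phi> ` U \<times> \<psi> ` V)) (\<lambda>(x, y). (\<phi> x, \<psi> y))"
    unfolding homeomorphic_map_maps by (auto simp: subtopology_Times)
  then show ?thesis
    unfolding is_chart_def using is_chartD(1,2)[OF c] is_chartD(1,2)[OF d] im
    by (simp add: openin_prod_Times_iff open_Times)
qed

lemma compatible_prod:
  fixes \<phi> \<phi>' :: "'x \<Rightarrow> 'e::euclidean_space" and \<psi> \<psi>' :: "'y \<Rightarrow> 'f::euclidean_space"
  assumes c: "is_chart X (U, \<phi>)" "is_chart X (U', \<phi>')" and d: "is_chart Y (V, \<psi>)" "is_chart Y (V', \<psi>')"
    and "Cr r (\<phi> ` (U \<inter> U')) (\<phi>' \<circ> inv_into U \<phi>)" "Cr r (\<psi> ` (V \<inter> V')) (\<psi>' \<circ> inv_into V \<psi>)"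
  shows "Cr r ((\<lambda>(x, y). (\<phi> x, \<psi> y)) ` (U \<times> V \<inter> U' \<times> V'))
    ((\<lambda>(x, y). (\<phi>' x, \<psi>' y)) \<circ> inv_into (U \<times> V) (\<lambda>(x, y). (\<phi> x, \<psi> y)))"
  unfolding Cr_def
proof (intro allI impI)
  fix k assume k: "enat k \<le> r"
  let ?p = "\<lambda>(x, y). (\<phi> x, \<psi> y)"
  have im: "?p ` (U \<times> V \<inter> U' \<times> V') = \<phi> ` (U \<inter> U') \<times> \<psi> ` (V \<inter> V')" by auto
  have "open (\<phi> ` (U \<inter> U'))" "open (\<psi> ` (V \<inter> V'))"
    using is_chartD(1)[OF c(1)] is_chartD(1)[OF c(2)] is_chartD(1)[OF d(1)] is_chartD(1)[OF d(2)]
    by (auto intro: is_chartD(4)[OF c(1)] is_chartD(4)[OF d(1)])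
  then have op: "open (\<phi> ` (U \<inter> U') \<times> \<psi> ` (V \<inter> V'))" by (rule open_Times)
  have inj: "inj_on ?p (U \<times> V)"
    using is_chartD(3)[OF c(1)] is_chartD(3)[OF d(1)] by (auto simp: inj_on_def)
  have "Ck k (\<phi> ` (U \<inter> U') \<times> \<psi> ` (V \<inter> V'))
     (\<lambda>z. ((\<phi>' \<circ> inv_into U \<phi>) (fst z), (\<psi>' \<circ> inv_into V \<psi>) (snd z)))"
  proof (rule Ck_Pair[OF op])
    have "Ck k (\<phi> ` (U \<inter> U')) (\<phi>' \<circ> inv_into U \<phi>)" "Ck k (\<psi> ` (V \<inter> V')) (\<psi>' \<circ> inv_into V \<psi>)"
      using assms(5,6) k unfolding Cr_def by blast+
    note 1 = Ck_compose[OF op _ this(1) Ck_linear[OF op bounded_linear_fst]]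
      and 2 = Ck_compose[OF op _ this(2) Ck_linear[OF op bounded_linear_snd]]
    show "Ck k (\<phi> ` (U \<inter> U') \<times> \<psi> ` (V \<inter> V')) (\<lambda>z. (\<phi>' \<circ> inv_into U \<phi>) (fst z))"
      by (rule 1) auto
    show "Ck k (\<phi> ` (U \<inter> U') \<times> \<psi> ` (V \<inter> V')) (\<lambda>z. (\<psi>' \<circ> inv_into V \<psi>) (snd z))"
      by (rule 2) auto
  qed
  then have "Ck k (\<phi> ` (U \<inter> U') \<times> \<psi> ` (V \<inter> V')) ((\<lambda>(x, y). (\<phi>' x, \<psi>' y)) \<circ> inv_into (U \<times> V) ?p)"
  proof (rule Ck_cong_open[OF op, rotated])
    fix z assume "z \<in> \<phi> ` (U \<inter> U') \<times> \<psi> ` (V \<inter> V')"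
    then obtain x y where xy: "x \<in> U" "y \<in> V" "z = ?p (x, y)" by auto
    then have "inv_into (U \<times> V) ?p z = (x, y)" using inv_into_f_f[OF inj] by blast
    then show "((\<phi>' \<circ> inv_into U \<phi>) (fst z), (\<psi>' \<circ> inv_into V \<psi>) (snd z)) =
        ((\<lambda>(x, y). (\<phi>' x, \<psi>' y)) \<circ> inv_into (U \<times> V) ?p) z"
      using xy is_chartD(3)[OF c(1)] is_chartD(3)[OF d(1)] by simp
  qed
  then show "Ck k (?p ` (U \<times> V \<inter> U' \<times> V')) ((\<lambda>(x, y). (\<phi>' x, \<psi>' y)) \<circ> inv_into (U \<times> V) ?p)"
    unfolding im .
qed

lemma atlas_prod:
  fixes D :: "('x set \<times> ('x \<Rightarrow> 'e::euclidean_space)) set" and E :: "('y set \<times> ('y \<Rightarrow> 'f::euclidean_space)) set"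
  assumes D: "atlas r X D" and E: "atlas r Y E"
  shows "atlas r (prod_topology X Y) (prod_charts D E)"
  unfolding atlas_def
proof (intro conjI ballI)
  fix c d assume "c \<in> prod_charts D E" "d \<in> prod_charts D E"
  then obtain U \<phi> V \<psi> U' \<phi>' V' \<psi>' where
    e: "c = (U \<times> V, \<lambda>(x, y). (\<phi> x, \<psi> y))" "d = (U' \<times> V', \<lambda>(x, y). (\<phi>' x, \<psi>' y))"
    and m: "(U, \<phi>) \<in> D" "(V, \<psi>) \<in> E" "(U', \<phi>') \<in> D" "(V', \<psi>') \<in> E"
    unfolding prod_charts_def by auto
  have ch: "is_chart X (U, \<phi>)" "is_chart X (U', \<phi>')" "is_chart Y (V, \<psi>)" "is_chart Y (V', \<psi>')"
    and co: "compatible r (U, \<phi>) (U', \<phi>')" "compatible r (V, \<psi>) (V', \<psi>')"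
    by (intro atlasD(1)[OF D] atlasD(1)[OF E] atlasD(2)[OF D] atlasD(2)[OF E] m)+
  show "compatible r c d"
    unfolding e compatible_def split
  proof
    show "Cr r ((\<lambda>(x, y). (\<phi> x, \<psi> y)) ` (U \<times> V \<inter> U' \<times> V'))
      ((\<lambda>(x, y). (\<phi>' x, \<psi>' y)) \<circ> inv_into (U \<times> V) (\<lambda>(x, y). (\<phi> x, \<psi> y)))"
      using co by (intro compatible_prod[OF ch]) (auto simp: compatible_def)
    show "Cr r ((\<lambda>(x, y). (\<phi>' x, \<psi>' y)) ` (U \<times> V \<inter> U' \<times> V'))
      ((\<lambda>(x, y). (\<phi> x, \<psi> y)) \<circ> inv_into (U' \<times> V') (\<lambda>(x, y). (\<phi>' x, \<psi>' y)))"
      using co by (subst Int_commute, intro compatible_prod[OF ch(2,1,4,3)]) (auto simp: compatible_def Int_commute)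
  qed
next
  fix c assume "c \<in> prod_charts D E"
  then obtain U \<phi> V \<psi> where "c = (U \<times> V, \<lambda>(x, y). (\<phi> x, \<psi> y))" "(U, \<phi>) \<in> D" "(V, \<psi>) \<in> E"
    unfolding prod_charts_def by auto
  then show "is_chart (prod_topology X Y) c"
    using is_chart_prod[OF atlasD(1)[OF D] atlasD(1)[OF E]] by simp
next
  have "\<Union> (fst ` prod_charts D E) = \<Union> (fst ` D) \<times> \<Union> (fst ` E)"
  proof (intro equalityI subsetI)
    fix z assume "z \<in> \<Union> (fst ` D) \<times> \<Union> (fst ` E)"
    then obtain U \<phi> V \<psi> where m: "(U, \<phi>) \<in> D" "(V, \<psi>) \<in> E" "z \<in> U \<times> V" by force
    then have "(U \<times> V, \<lambda>(x, y). (\<phi> x, \<psi> y)) \<in> prod_charts D E" unfolding prod_charts_def by blast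
    then show "z \<in> \<Union> (fst ` prod_charts D E)" using m(3) by force
  qed (force simp: prod_charts_def)
  then show "\<Union> (fst ` prod_charts D E) = topspace (prod_topology X Y)"
    using atlasD(3)[OF D] atlasD(3)[OF E] by simp
qed

text \<open>Gives reflexivity of \<open>diffeomorphic\<close>, from which distinct index sets are
  seen to yield distinct structures.\<close>

lemma smooth_map_id:
  assumes "diff_structure r X A"
  shows "smooth_map r X A X A (\<lambda>x. x)"
proof -
  have "Cr r (\<phi> ` (U \<inter> V)) (\<psi> \<circ> inv_into U \<phi>)" if "(U, \<phi>) \<in> A" "(V, \<psi>) \<in> A" for U \<phi> V \<psi>
    using atlasD(2)[OF diff_structure_atlas[OF assms] that] unfolding compatible_def by simp
  then show ?thesis unfolding smooth_map_def by (auto simp: comp_def)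
qed

section \<open>Charts of the long ray and invariant squares\<close>

lemma initial_chart_open_map:
  assumes g: "initial_chart a g" and W: "open W" "W \<subseteq> upto_blk a"
  shows "open (g ` W)"
proof (subst open_subopen, intro ballI)
  fix s assume "s \<in> g ` W"
  then obtain x where x: "x \<in> W" "s = g x" by blast
  obtain u v where uv: "u < x" "x < v" "{u<..<v} \<subseteq> W" using open_ll_interval[OF W(1) x(1)] by blast
  \<comment> \<open>The end points are moved inward so that they lie in \<open>W\<close>, hence in
    the domain of \<open>g\<close>.\<close>
  obtain u' v' where uv': "u < u'" "u' < x" "x < v'" "v' < v" using dense[OF uv(1)] dense[OF uv(2)] by blast
  have "u' \<in> W" "v' \<in> W" using uv uv' by (auto intro!: subsetD[OF uv(3)])
  then have D: "u' \<in> upto_blk a" "v' \<in> upto_blk a" "x \<in> upto_blk a" using x(1) W(2) by blast+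
  have mono: "g y < g z \<longleftrightarrow> y < z" if "y \<in> upto_blk a" "z \<in> upto_blk a" for y z
    using g that unfolding initial_chart_def by (metis strict_mono_on_less)
  have "g ` upto_blk a \<inter> {g u'<..<g v'} \<subseteq> g ` W"
  proof
    fix t assume "t \<in> g ` upto_blk a \<inter> {g u'<..<g v'}"
    then obtain y where y: "y \<in> upto_blk a" "t = g y" "g u' < g y" "g y < g v'" by auto
    then have "u' < y" "y < v'" using mono[OF D(1) y(1)] mono[OF y(1) D(2)] by simp_all
    then have "y \<in> {u<..<v}" using uv' by auto
    then show "t \<in> g ` W" using uv(3) y(2) by blast
  qed
  moreover have "s \<in> g ` upto_blk a \<inter> {g u'<..<g v'}"
    using mono[OF D(1,3)] mono[OF D(3,2)] uv' D(3) x(2) by auto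
  moreover have "open (g ` upto_blk a \<inter> {g u'<..<g v'})"
    using g unfolding initial_chart_def by (intro open_Int) auto
  ultimately show "\<exists>T. open T \<and> s \<in> T \<and> T \<subseteq> g ` W" by blast
qed

text \<open>The values \<open>e / 2\<close> to both sides of \<open>g x\<close> are attained, and
  everything between the two points attaining them has values within \<open>e\<close>. With
  \<open>Z = UNIV\<close> this also shows that the segment itself is open.\<close>

lemma initial_chart_continuous:
  assumes g: "initial_chart a g" and Z: "open Z"
  shows "open (upto_blk a \<inter> g -` Z)"
proof (subst open_subopen, intro ballI)
  fix x assume x: "x \<in> upto_blk a \<inter> g -` Z"
  have "open (Z \<inter> g ` upto_blk a)" using g Z unfolding initial_chart_def by blast
  then obtain e where e: "e > 0" "\<And>s. dist s (g x) < e \<Longrightarrow> s \<in> Z \<inter> g ` upto_blk a"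
    using x unfolding open_dist by blast
  have im: "g x - e / 2 \<in> g ` upto_blk a" "g x + e / 2 \<in> g ` upto_blk a"
    using e(2)[of "g x - e / 2"] e(2)[of "g x + e / 2"] e(1) by (auto simp: dist_real_def)
  obtain u where u: "g x - e / 2 = g u" "u \<in> upto_blk a" using im(1) by (rule imageE)
  obtain v where v: "g x + e / 2 = g v" "v \<in> upto_blk a" using im(2) by (rule imageE)
  note uv = u(2) v(2) u(1)[symmetric] v(1)[symmetric]
  have mono: "g y < g z \<longleftrightarrow> y < z" if "y \<in> upto_blk a" "z \<in> upto_blk a" for y z
    using g that unfolding initial_chart_def by (metis strict_mono_on_less)
  have xD: "x \<in> upto_blk a" using x by blast
  have "{u<..<v} \<subseteq> upto_blk a \<inter> g -` Z"
  proof
    fix y assume y: "y \<in> {u<..<v}"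
    then have "y \<le> v" by (simp add: less_imp_le)
    then have yD: "y \<in> upto_blk a" using blk_mono[of y v] uv(2) by auto
    have "g u < g y" "g y < g v" using mono[OF uv(1) yD] mono[OF yD uv(2)] y by simp_all
    then have "dist (g y) (g x) < e" using uv(3,4) e(1) by (simp add: dist_real_def abs_less_iff)
    then show "y \<in> upto_blk a \<inter> g -` Z" using e(2) yD by blast
  qed
  moreover have "x \<in> {u<..<v}" using mono[OF uv(1) xD] mono[OF xD uv(2)] uv(3,4) e(1) by simp
  ultimately show "\<exists>T. open T \<and> x \<in> T \<and> T \<subseteq> upto_blk a \<inter> g -` Z"
    by (intro exI[of _ "{u<..<v}"]) simp
qed

lemma initial_chart_is_chart:
  assumes g: "initial_chart a g"
  shows "is_chart Lplus (toL ` upto_blk a, g \<circ> fromL)"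
proof -
  let ?U = "toL ` upto_blk a"
  have im: "(g \<circ> fromL) ` toL ` W = g ` W" for W by (simp add: image_comp comp_def)
  have "open (upto_blk a)" using initial_chart_continuous[OF g open_UNIV] by simp
  then have U: "openin Lplus ?U" by (rule openin_Lplus_toL)
  then have top: "topspace (subtopology Lplus ?U) = ?U" using openin_subset by fastforce
  have "homeomorphic_map (subtopology Lplus ?U) (top_of_set (g ` upto_blk a)) (g \<circ> fromL)"
  proof (rule bijective_open_imp_homeomorphic_map)
    have "continuous_map (subtopology Lplus ?U) euclidean (g \<circ> fromL)"
      unfolding continuous_map_def
    proof (intro conjI allI impI)
      fix Z :: "real set" assume "openin euclidean Z"
      then have "openin Lplus (toL ` (upto_blk a \<inter> g -` Z))"
        using initial_chart_continuous[OF g] openin_Lplus_toL by simp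
      then have "openin (subtopology Lplus ?U) (toL ` (upto_blk a \<inter> g -` Z))"
        by (subst openin_open_subtopology[OF U]) auto
      moreover have "{x \<in> topspace (subtopology Lplus ?U). (g \<circ> fromL) x \<in> Z} = toL ` (upto_blk a \<inter> g -` Z)"
        unfolding top by auto
      ultimately show "openin (subtopology Lplus ?U) {x \<in> topspace (subtopology Lplus ?U). (g \<circ> fromL) x \<in> Z}"
        by simp
    qed simp
    then show "continuous_map (subtopology Lplus ?U) (top_of_set (g ` upto_blk a)) (g \<circ> fromL)"
      unfolding continuous_map_in_subtopology top using im by auto
    show "open_map (subtopology Lplus ?U) (top_of_set (g ` upto_blk a)) (g \<circ> fromL)"
      unfolding open_map_def
    proof (intro allI impI)
      fix W assume "openin (subtopology Lplus ?U) W"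
      then have W: "openin Lplus W" "W \<subseteq> ?U" using openin_open_subtopology[OF U] by blast+
      then obtain V where V: "V \<subseteq> upto_blk a" "W = toL ` V" by (metis subset_imageE)
      have "openin euclidean {x \<in> topspace euclidean. toL x \<in> W}"
        by (rule openin_continuous_map_preimage[OF continuous_map_toL W(1)])
      moreover have "{x \<in> topspace euclidean. toL x \<in> W} = V"
        using V(2) inj_toL by (auto dest: injD)
      ultimately have "open (g ` V)" using initial_chart_open_map[OF g _ V(1)] by simp
      then show "openin (top_of_set (g ` upto_blk a)) ((g \<circ> fromL) ` W)"
        unfolding V(2) im using V(1) by (simp add: image_mono open_subset)
    qed
    show "inj_on (g \<circ> fromL) (topspace (subtopology Lplus ?U))"
      unfolding top using initial_chart_inj[OF g] by (auto simp: inj_on_def)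
  qed (simp only: top im topspace_euclidean_subtopology)
  then show ?thesis
    unfolding is_chart_def using U im g by (simp add: initial_chart_def)
qed

lemma transition_smooth_rel:
  assumes rel: "smooth_rel X \<phi> \<psi>" and inj: "inj_on \<phi> Y" "X \<subseteq> Y"
  shows "Cr r ((\<phi> \<circ> fromL) ` toL ` X) ((\<psi> \<circ> fromL) \<circ> inv_into (toL ` Y) (\<phi> \<circ> fromL))"
  unfolding Cr_def
proof (intro allI impI)
  fix k
  obtain u where u: "smooth_inc (\<phi> ` X) u" "\<forall>x\<in>X. \<psi> x = u (\<phi> x)"
    using rel unfolding smooth_rel_def by blast
  have im: "(\<phi> \<circ> fromL) ` toL ` X = \<phi> ` X" by (simp add: image_comp comp_def)
  have inj': "inj_on (\<phi> \<circ> fromL) (toL ` Y)" using inj(1) by (auto simp: inj_on_def)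
  show "Ck k ((\<phi> \<circ> fromL) ` toL ` X) ((\<psi> \<circ> fromL) \<circ> inv_into (toL ` Y) (\<phi> \<circ> fromL))"
    unfolding im
  proof (rule Ck_cong_open[OF smooth_incD(1)[OF u(1)] _ smooth_incD(2)[OF u(1)]])
    fix s assume "s \<in> \<phi> ` X"
    then obtain x where x: "x \<in> X" "s = (\<phi> \<circ> fromL) (toL x)" by auto
    then have "inv_into (toL ` Y) (\<phi> \<circ> fromL) s = toL x"
      using inv_into_f_f[OF inj'] inj(2) by blast
    then show "u s = ((\<psi> \<circ> fromL) \<circ> inv_into (toL ` Y) (\<phi> \<circ> fromL)) s" using u(2) x by simp
  qed
qed

definition ray_atlas :: "(om \<Rightarrow> ll \<Rightarrow> real) \<Rightarrow> (lpt set \<times> (lpt \<Rightarrow> real)) set" where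
  "ray_atlas G = range (\<lambda>a. (toL ` upto_blk a, G a \<circ> fromL))"

lemma atlas_ray_atlas:
  assumes G: "\<And>a. initial_chart a (G a)" and rel: "\<And>a b. a \<le> b \<Longrightarrow> smooth_rel (upto_blk a) (G a) (G b)"
  shows "atlas r Lplus (ray_atlas G)"
  unfolding atlas_def
proof (intro conjI ballI)
  have co: "compatible r (toL ` upto_blk a, G a \<circ> fromL) (toL ` upto_blk b, G b \<circ> fromL)" if "a \<le> b" for a b
  proof -
    have sub: "upto_blk a \<subseteq> upto_blk b" using that by auto
    have inj: "inj_on (G b) (upto_blk b)" "inj_on (G a) (upto_blk a)" using initial_chart_inj[OF G] by auto
    have "toL ` upto_blk a \<inter> toL ` upto_blk b = toL ` upto_blk a" using sub by blast
    then show ?thesis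
      unfolding compatible_def split
      using transition_smooth_rel[OF rel[OF that] inj(2) order_refl]
        transition_smooth_rel[OF smooth_rel_sym[OF rel[OF that] inj_on_subset[OF inj(1) sub]] inj(1) sub]
      by simp
  qed
  fix c d assume "c \<in> ray_atlas G" "d \<in> ray_atlas G"
  then obtain a b where "c = (toL ` upto_blk a, G a \<circ> fromL)" "d = (toL ` upto_blk b, G b \<circ> fromL)"
    unfolding ray_atlas_def by blast
  then show "compatible r c d" using co[of a b] co[of b a] compatible_sym[of r d c] by (metis linorder_linear)
next
  show "is_chart Lplus c" if "c \<in> ray_atlas G" for c
    using that initial_chart_is_chart[OF G] unfolding ray_atlas_def by blast
  show "\<Union> (fst ` ray_atlas G) = topspace Lplus"
    unfolding topspace_Lplus ray_atlas_def by auto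
qed

section \<open>Corners and indices with invariant squares\<close>

definition corner :: "om \<Rightarrow> ll" where "corner a = (THE x. blk x = a \<and> off x = 0)"

lemma corner:
  assumes "a \<noteq> om_zero"
  shows "blk (corner a) = a" "off (corner a) = 0"
proof -
  obtain x where "blk x = a" "off x = 0" using ex_ll[of 0 a] assms by auto
  then have "\<exists>!x. blk x = a \<and> off x = 0" by (auto intro: ll_eqI)
  from theI'[OF this, folded corner_def]
  show "blk (corner a) = a" "off (corner a) = 0" by auto
qed

lemma less_corner_iff: "a \<noteq> om_zero \<Longrightarrow> x < corner a \<longleftrightarrow> blk x < a"
  using corner[of a] off_bounds(1)[of x] by (auto simp: less_ll_def)

lemma corner_less_corner: "a < b \<Longrightarrow> a \<noteq> om_zero \<Longrightarrow> corner a < corner b"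
  using corner[of a] less_corner_iff[of b "corner a"] om_zero_le[of a] by (metis not_less)

text \<open>Countable boundedness gives an upper bound and the well-order a least one; strict growth
  keeps the supremum above every term.\<close>

lemma ex_sup_om:
  fixes c :: "nat \<Rightarrow> om"
  assumes "strict_mono c"
  obtains s where "\<And>n. c n < s" "\<And>x. x < s \<Longrightarrow> \<exists>n. x < c n"
proof -
  obtain b where b: "\<And>a. a \<in> range c \<Longrightarrow> a < b" using countable_bounded_om[of "range c"] by auto
  define s where "s = (LEAST b. \<forall>n. c n \<le> b)"
  have s: "c n \<le> s" for n
    unfolding s_def using LeastI[of "\<lambda>b. \<forall>n. c n \<le> b" b] b less_imp_le by blast
  show ?thesis
  proof
    show "c n < s" for n using assms s[of "Suc n"] by (metis lessI order.strict_trans2 strict_monoD)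
    show "\<exists>n. x < c n" if "x < s" for x
      using not_less_Least[of x "\<lambda>b. \<forall>n. c n \<le> b"] that unfolding s_def by (auto simp: not_le)
  qed
qed

definition square :: "om \<Rightarrow> (ll \<times> ll) set" where
  "square a = below_blk a \<times> below_blk a"

lemma square_mono: "a \<le> b \<Longrightarrow> square a \<subseteq> square b"
  by (auto simp: square_def)

text \<open>The images of the countably many rational points below \<open>b\<close> are bounded, hence so is the image of their closure.\<close>
lemma image_square_bounded:
  fixes h :: "ll \<times> ll \<Rightarrow> ll \<times> ll"
  assumes h: "continuous_on UNIV h"
  obtains c where "h ` square b \<subseteq> square c"
proof -
  let ?R = "rat_points \<inter> upto_blk b"
  have "countable (?R \<times> ?R)" using countable_rat_points by blast
  then have "countable ((blk \<circ> fst \<circ> h) ` (?R \<times> ?R) \<union> (blk \<circ> snd \<circ> h) ` (?R \<times> ?R))" by blast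
  then obtain d where d: "\<And>a. a \<in> (blk \<circ> fst \<circ> h) ` (?R \<times> ?R) \<union> (blk \<circ> snd \<circ> h) ` (?R \<times> ?R) \<Longrightarrow> a < d"
    using countable_bounded_om by metis
  have dz: "d \<noteq> om_zero"
  proof -
    obtain x where "blk x = om_zero" "off x = 1/2" using ex_ll[of "1/2" om_zero] by auto
    moreover have "(1/2 :: real) \<in> \<rat>" by simp
    ultimately have "x \<in> ?R" unfolding rat_points_def by (metis (mono_tags) IntI mem_Collect_eq om_zero_le)
    then have "blk (fst (h (x, x))) < d" by (intro d) force
    then show ?thesis by (metis not_less om_zero_le)
  qed
  \<comment> \<open>A closed box is used because membership in it passes to closures; it needs a
    corner, hence \<open>d \<noteq> om_zero\<close>.\<close>
  let ?S = "{..corner d} \<times> {..corner d}"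
  have "h ` (?R \<times> ?R) \<subseteq> ?S"
  proof
    fix w assume "w \<in> h ` (?R \<times> ?R)"
    then obtain z where z: "z \<in> ?R \<times> ?R" "w = h z" by blast
    have "blk (fst (h z)) < d" "blk (snd (h z)) < d" using z(1) by (auto intro!: d)
    then show "w \<in> ?S" using less_corner_iff[OF dz] z(2) by (auto simp: mem_Times_iff less_imp_le)
  qed
  then have "h ` closure (?R \<times> ?R) \<subseteq> ?S"
    using continuous_on_subset[OF h] by (intro image_closure_subset closed_Times closed_atMost) auto
  moreover have "square b \<subseteq> closure (?R \<times> ?R)"
  proof -
    have "x \<in> closure ?R" if x: "blk x < b" for x
      unfolding closure_iff_nhds_not_empty
    proof (intro allI impI)
      fix A V assume V: "V \<subseteq> A" "open V" "x \<in> V"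
      obtain u v where uv: "u < x" "x < v" "{u<..<v} \<subseteq> V" using open_ll_interval[OF V(2,3)] by blast
      obtain z where z: "z \<in> rat_points" "u < z" "z < x" using rat_points_dense[OF uv(1)] by blast
      then have "blk z \<le> b" using blk_mono[of z x] x by (meson less_imp_le order.trans)
      moreover have "z \<in> V" using z uv by (intro subsetD[OF uv(3)]) auto
      ultimately show "?R \<inter> A \<noteq> {}" using z(1) V(1) by blast
    qed
    then show ?thesis unfolding square_def closure_Times by blast
  qed
  ultimately have hS: "h ` square b \<subseteq> ?S" by blast
  obtain c where c: "d < c" using ex_greater_om by blast
  have "blk x < c" if "x \<le> corner d" for x
    using blk_mono[OF that] corner(1)[OF dz] c by simp
  then have "?S \<subseteq> square c" by (auto simp: square_def)
  then show ?thesis using that hS by blast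
qed

text \<open>Only an inclusion; asking it of a map and of its inverse yields equality. The index
  \<open>om_zero\<close> is excluded since its square is empty and it has no corner.\<close>

definition invariant_index :: "(ll \<times> ll \<Rightarrow> ll \<times> ll) \<Rightarrow> om \<Rightarrow> bool" where
  "invariant_index h c \<longleftrightarrow> c \<noteq> om_zero \<and> h ` square c \<subseteq> square c"

text \<open>The square at the supremum is the union of the squares along the sequence, and each of
  these is carried into the next.\<close>

lemma invariant_index_sup:
  assumes c: "\<And>n. h ` square (c n) \<subseteq> square (c (Suc n))"
    and s: "\<And>n. c n < s" "\<And>x. x < s \<Longrightarrow> \<exists>n. x < c n"
    and mono: "strict_mono c"
  shows "invariant_index h s"
  unfolding invariant_index_def
proof
  show "s \<noteq> om_zero" using s(1)[of 0] by (metis not_less om_zero_le)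
  show "h ` square s \<subseteq> square s"
  proof
    fix w assume "w \<in> h ` square s"
    then obtain x y where w: "w = h (x, y)" "blk x < s" "blk y < s" by (auto simp: square_def)
    then have "max (blk x) (blk y) < s" by simp
    then obtain n where "max (blk x) (blk y) < c n" using s(2) by blast
    then have "(x, y) \<in> square (c n)" by (simp add: square_def)
    then have "w \<in> square (c (Suc n))" using c w(1) by blast
    then show "w \<in> square s" using square_mono[of "c (Suc n)" s] s(1) less_imp_le by blast
  qed
qed

text \<open>The standard closing-off argument: bound the images of a square, enlarge the index,
  repeat countably often. Each step bounds both images, so one index serves both maps.\<close>

lemma ex_invariant_index:
  assumes "continuous_on UNIV h" "continuous_on UNIV k"
  shows "\<exists>c>b. invariant_index h c \<and> invariant_index k c"
proof -
  have step: "\<exists>d>c. h ` square c \<subseteq> square d \<and> k ` square c \<subseteq> square d" for c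
  proof -
    obtain d1 d2 e where 1: "h ` square c \<subseteq> square d1" "k ` square c \<subseteq> square d2" "c < e"
      using image_square_bounded[OF assms(1)] image_square_bounded[OF assms(2)] ex_greater_om by metis
    let ?d = "max e (max d1 d2)"
    have "square d1 \<subseteq> square ?d" "square d2 \<subseteq> square ?d"
      using square_mono[of d1 ?d] square_mono[of d2 ?d] by (simp_all add: le_max_iff_disj)
    moreover have "c < ?d" using 1(3) by (simp add: less_max_iff_disj)
    ultimately show ?thesis using 1 by blast
  qed
  have "\<exists>c. \<forall>n. (b < c n) \<and> (c n < c (Suc n) \<and> h ` square (c n) \<subseteq> square (c (Suc n)) \<and> k ` square (c n) \<subseteq> square (c (Suc n)))"
    by (rule dependent_nat_choice) (use ex_greater_om step less_trans in blast)+
  then obtain c where c: "\<And>n. b < c n" "\<And>n. c n < c (Suc n)" "\<And>n. h ` square (c n) \<subseteq> square (c (Suc n))"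
    "\<And>n. k ` square (c n) \<subseteq> square (c (Suc n))" by blast
  have mono: "strict_mono c" using c(2) by (simp add: strict_mono_Suc_iff)
  obtain s where s: "\<And>n. c n < s" "\<And>x. x < s \<Longrightarrow> \<exists>n. x < c n" using ex_sup_om[OF mono] by blast
  have "invariant_index h s" "invariant_index k s"
    using invariant_index_sup[OF c(3) s mono] invariant_index_sup[OF c(4) s mono] by simp_all
  then show ?thesis using c(1)[of 0] s(1)[of 0] less_trans by blast
qed

text \<open>Unboundedness of the invariant indices gives the sequence, and its supremum is invariant
  because the set of such indices is closed. The bound \<open>b\<close> pushes \<open>s\<close> past
  any prescribed index.\<close>

lemma ex_invariant_sequence:
  assumes "continuous_on UNIV h" "continuous_on UNIV k"
  obtains c :: "nat \<Rightarrow> om" and s where "strict_mono c" "b < s" "\<And>n. c n < s" "\<And>x. x < s \<Longrightarrow> \<exists>n. x < c n"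
    "\<And>n. invariant_index h (c n) \<and> invariant_index k (c n)" "invariant_index h s \<and> invariant_index k s"
proof -
  have "\<exists>c. \<forall>n. (b < c n \<and> invariant_index h (c n) \<and> invariant_index k (c n)) \<and> c n < c (Suc n)"
    by (rule dependent_nat_choice) (use ex_invariant_index[OF assms] less_trans in blast)+
  then obtain c where c: "\<And>n. b < c n" "\<And>n. invariant_index h (c n)" "\<And>n. invariant_index k (c n)"
    "\<And>n. c n < c (Suc n)" by blast
  have mono: "strict_mono c" using c(4) by (simp add: strict_mono_Suc_iff)
  obtain s where s: "\<And>n. c n < s" "\<And>x. x < s \<Longrightarrow> \<exists>n. x < c n" using ex_sup_om[OF mono] by blast
  have "h ` square (c n) \<subseteq> square (c (Suc n))" "k ` square (c n) \<subseteq> square (c (Suc n))" for n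
    using c(2,3) square_mono[of "c n" "c (Suc n)"] c(4)[of n] less_imp_le unfolding invariant_index_def by blast+
  then have "invariant_index h s \<and> invariant_index k s" using invariant_index_sup[OF _ s mono] by blast
  then show ?thesis using that[OF mono _ s] c s(1)[of 0] less_trans by blast
qed

text \<open>The equation with \<open>max\<close> describes the two edges that meet at
  \<open>(corner a, corner a)\<close>. By continuity the closed square goes into itself, and a
  boundary point cannot enter the open square because \<open>k\<close> would bring it back
  inside.\<close>

lemma boundary_invariant:
  assumes h: "continuous_on UNIV h" and kh: "\<And>z. k (h z) = z"
    and inv: "invariant_index h a" "invariant_index k a"
    and xy: "max x y = corner a"
  shows "max (fst (h (x, y))) (snd (h (x, y))) = corner a"
proof -
  have a: "a \<noteq> om_zero" using inv(1) unfolding invariant_index_def by blast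
  let ?S = "{..corner a} \<times> {..corner a}"
  have "h ` square a \<subseteq> ?S"
  proof
    fix w assume "w \<in> h ` square a"
    then have "w \<in> square a" using inv(1) unfolding invariant_index_def by (meson subsetD)
    then have "fst w < corner a" "snd w < corner a"
      unfolding less_corner_iff[OF a] square_def by (simp_all add: mem_Times_iff)
    then show "w \<in> ?S" by (simp add: mem_Times_iff less_imp_le)
  qed
  then have "h ` closure (square a) \<subseteq> ?S"
    using continuous_on_subset[OF h] by (intro image_closure_subset closed_Times closed_atMost) auto
  moreover have "z \<in> closure (below_blk a)" if z: "z \<le> corner a" for z
    unfolding closure_iff_nhds_not_empty
  proof (intro allI impI)
    fix A V assume V: "V \<subseteq> A" "open V" "z \<in> V"
    obtain u v where uv: "u < z" "z < v" "{u<..<v} \<subseteq> V" using open_ll_interval[OF V(2,3)] by blast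
    obtain w where w: "u < w" "w < z" using dense[OF uv(1)] by blast
    then have "blk w < a" using z less_corner_iff[OF a, of w] by auto
    moreover have "w \<in> V" using w uv by (intro subsetD[OF uv(3)]) auto
    ultimately show "below_blk a \<inter> A \<noteq> {}" using V(1) by blast
  qed
  then have "(x, y) \<in> closure (square a)"
    using xy unfolding square_def closure_Times by (metis max.cobounded1 max.cobounded2 mem_Sigma_iff)
  ultimately have le: "fst (h (x, y)) \<le> corner a" "snd (h (x, y)) \<le> corner a" by auto
  have "h (x, y) \<notin> square a"
  proof
    assume "h (x, y) \<in> square a"
    then have "(x, y) \<in> square a" using inv(2) kh unfolding invariant_index_def by (metis imageI subsetD)
    then have "x < corner a" "y < corner a" using less_corner_iff[OF a] unfolding square_def by auto
    then show False using xy by (metis max_def less_irrefl)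
  qed
  then have "\<not> fst (h (x, y)) < corner a \<or> \<not> snd (h (x, y)) < corner a"
    using less_corner_iff[OF a] unfolding square_def by (metis mem_Collect_eq mem_Times_iff)
  then show ?thesis using le by (auto simp: max_def)
qed

section \<open>The exponents are invariants\<close>

lemma corner_tendsto:
  assumes nz: "\<And>n. c n \<noteq> om_zero" and c: "strict_mono (c :: nat \<Rightarrow> om)"
    and s: "\<And>n. c n < s" "\<And>x. x < s \<Longrightarrow> \<exists>n. x < c n"
  shows "(\<lambda>n. corner (c n)) \<longlonglongrightarrow> corner s"
proof (rule order_tendstoI)
  have sz: "s \<noteq> om_zero" using s(1)[of 0] by (metis not_less om_zero_le)
  show "\<forall>\<^sub>F n in sequentially. u < corner (c n)" if u: "u < corner s" for u
  proof -
    have "blk u < s" using u less_corner_iff[OF sz] by simp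
    then obtain m where m: "blk u < c m" using s(2) by blast
    have "u < corner (c n)" if "n \<ge> m" for n
    proof -
      have "c m \<le> c n" using c that by (simp add: strict_mono_less_eq)
      then show ?thesis unfolding less_corner_iff[OF nz] using m by simp
    qed
    then show ?thesis unfolding eventually_sequentially by blast
  qed
  show "\<forall>\<^sub>F n in sequentially. corner (c n) < u" if "corner s < u" for u
    using less_trans[OF corner_less_corner[OF s(1) nz] that] by (intro always_eventually allI)
qed

text \<open>If the image of \<open>(corner s, y)\<close> is not \<open>(corner s, corner s)\<close>,
  exactly one coordinate equals \<open>corner s\<close> and the other is strictly smaller. Along the
  approximating points the smaller one stays away from \<open>corner s\<close>, so it drops below
  \<open>corner (c n)\<close>, and the remaining coordinate must be \<open>corner (c n)\<close>
  exactly.\<close>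

lemma boundary_coordinate:
  assumes h: "continuous_on UNIV h" and kh: "\<And>z. k (h z) = z"
    and inv: "\<And>n. invariant_index h (c n)" "\<And>n. invariant_index k (c n)" "invariant_index h s" "invariant_index k s"
    and c: "strict_mono (c :: nat \<Rightarrow> om)" and s: "\<And>n. c n < s" "\<And>x. x < s \<Longrightarrow> \<exists>n. x < c n"
  obtains y \<pi> where "blk y < s" "\<pi> = fst \<or> \<pi> = snd" "max (fst (h (corner s, y))) (snd (h (corner s, y))) = corner s"
    "\<pi> (h (corner s, y)) = corner s"
    "\<forall>\<^sub>F n in sequentially. max (fst (h (corner (c n), y))) (snd (h (corner (c n), y))) = corner (c n)
      \<and> \<pi> (h (corner (c n), y)) = corner (c n)"
proof -
  have nz: "c n \<noteq> om_zero" for n using inv(1) unfolding invariant_index_def by blast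
  have sz: "s \<noteq> om_zero" using inv(3) unfolding invariant_index_def by blast
  have max_s: "max (fst (h (corner s, y))) (snd (h (corner s, y))) = corner s" if "blk y < s" for y
    using that by (intro boundary_invariant[OF h kh inv(3,4)] max_absorb1) (simp add: less_corner_iff[OF sz] less_imp_le)
  obtain y where y: "blk y < s" "h (corner s, y) \<noteq> (corner s, corner s)"
  proof -
    \<comment> \<open>By injectivity at most one \<open>y\<close> is sent to the corner of the
      square, so two candidates suffice.\<close>
    let ?y = "\<lambda>n. corner (c n)"
    have "?y 0 < ?y 1" by (rule corner_less_corner[OF _ nz]) (use c in \<open>simp add: strict_mono_less\<close>)
    then have "(corner s, ?y 0) \<noteq> (corner s, ?y 1)" by auto
    then have "h (corner s, ?y 0) \<noteq> h (corner s, ?y 1)" using kh by metis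
    then have "h (corner s, ?y 0) \<noteq> (corner s, corner s) \<or> h (corner s, ?y 1) \<noteq> (corner s, corner s)" by metis
    moreover have "blk (?y n) < s" for n using corner(1)[OF nz] s(1) by simp
    ultimately show ?thesis using that by blast
  qed
  obtain N where N: "blk y < c N" using s(2)[OF y(1)] by blast
  have max_c: "max (fst (h (corner (c n), y))) (snd (h (corner (c n), y))) = corner (c n)" if "n \<ge> N" for n
  proof (intro boundary_invariant[OF h kh inv(1,2)] max_absorb1 less_imp_le)
    have "c N \<le> c n" using c that by (simp add: strict_mono_less_eq)
    then show "y < corner (c n)" unfolding less_corner_iff[OF nz] using N by simp
  qed
  have "(\<lambda>n. (corner (c n), y)) \<longlonglongrightarrow> (corner s, y)"
    by (intro tendsto_Pair corner_tendsto[OF nz c s] tendsto_const)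
  then have lim: "(\<lambda>n. h (corner (c n), y)) \<longlonglongrightarrow> h (corner s, y)"
    using h by (intro isCont_tendsto_compose[of _ h]) (simp_all add: continuous_on_eq_continuous_at)
  \<comment> \<open>\<open>l\<close> lies below some \<open>corner (c m)\<close>, and this fixed
    bound persists since the corners increase.\<close>
  have ev: "\<forall>\<^sub>F n in sequentially. \<rho> n < corner (c n)" if "\<rho> \<longlonglongrightarrow> l" "l < corner s" for \<rho> l
  proof -
    have "blk l < s" using \<open>l < corner s\<close> less_corner_iff[OF sz] by simp
    then obtain m where "blk l < c m" using s(2) by blast
    then have m: "l < corner (c m)" using less_corner_iff[OF nz] by simp
    have "\<forall>\<^sub>F n in sequentially. n \<ge> m" by (rule eventually_ge_at_top)
    with order_tendstoD(2)[OF \<open>\<rho> \<longlonglongrightarrow> l\<close> m] show ?thesis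
    proof eventually_elim
      case (elim n)
      have "corner (c m) \<le> corner (c n)"
        using corner_less_corner[OF _ nz, of m "c n"] c elim(2) by (metis le_less strict_mono_less)
      then show ?case using elim(1) by simp
    qed
  qed
  have evN: "\<forall>\<^sub>F n in sequentially. n \<ge> N" by (rule eventually_ge_at_top)
  show ?thesis
  proof (cases "snd (h (corner s, y)) < corner s")
    case True
    show ?thesis
    proof (rule that[of y fst])
      show "fst (h (corner s, y)) = corner s" using max_s[OF y(1)] True by (auto simp: max_def split: if_splits)
      show "\<forall>\<^sub>F n in sequentially. max (fst (h (corner (c n), y))) (snd (h (corner (c n), y))) = corner (c n)
        \<and> fst (h (corner (c n), y)) = corner (c n)"
        using ev[OF tendsto_snd[OF lim] True] evN
        by eventually_elim (use max_c in \<open>force simp: max_def split: if_splits\<close>)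
    qed (use y max_s in auto)
  next
    case False
    then have eq: "snd (h (corner s, y)) = corner s" using max_s[OF y(1)] by (auto simp: max_def split: if_splits)
    then have lt: "fst (h (corner s, y)) < corner s"
      using max_s[OF y(1)] y(2) by (metis max.cobounded1 order_le_less prod.collapse)
    show ?thesis
    proof (rule that[of y snd])
      show "\<forall>\<^sub>F n in sequentially. max (fst (h (corner (c n), y))) (snd (h (corner (c n), y))) = corner (c n)
        \<and> snd (h (corner (c n), y)) = corner (c n)"
        using ev[OF tendsto_fst[OF lim] lt] evN
        by eventually_elim (use max_c in \<open>force simp: max_def split: if_splits\<close>)
    qed (use y(1) max_s[OF y(1)] eq in simp_all)
  qed
qed

section \<open>Comparison of the rates at a corner\<close>

lemma differentiable_imp_pointwise_Lipschitz:
  fixes \<Phi> :: "'a::euclidean_space \<Rightarrow> 'b::euclidean_space"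
  assumes "\<Phi> differentiable (at z)"
  obtains K where "\<forall>\<^sub>F w in nhds z. norm (\<Phi> w - \<Phi> z) \<le> K * norm (w - z)"
proof -
  obtain D where D: "(\<Phi> has_derivative D) (at z)" using assms unfolding differentiable_def by blast
  then have lin: "bounded_linear D" by (rule has_derivative_bounded_linear)
  \<comment> \<open>Near \<open>z\<close> the remainder is at most \<open>1\<close> times the
    distance; this is the \<open>1\<close> in the constant \<open>1 + onorm D\<close>.\<close>
  obtain d where d: "d > 0" "\<And>w. norm (w - z) < d \<Longrightarrow> norm (\<Phi> w - \<Phi> z - D (w - z)) \<le> 1 * norm (w - z)"
    using D unfolding has_derivative_at_alt by (metis zero_less_one)
  have "norm (\<Phi> w - \<Phi> z) \<le> (1 + onorm D) * norm (w - z)" if "norm (w - z) < d" for w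
  proof -
    have "norm (\<Phi> w - \<Phi> z) \<le> norm (\<Phi> w - \<Phi> z - D (w - z)) + norm (D (w - z))"
      using norm_triangle_ineq[of "\<Phi> w - \<Phi> z - D (w - z)" "D (w - z)"] by simp
    also have "\<dots> \<le> 1 * norm (w - z) + onorm D * norm (w - z)"
      by (intro add_mono d(2) that onorm[OF lin])
    finally show ?thesis by (simp add: algebra_simps)
  qed
  then have "\<forall>\<^sub>F w in nhds z. norm (\<Phi> w - \<Phi> z) \<le> (1 + onorm D) * norm (w - z)"
    unfolding eventually_nhds_metric using d(1) by (metis dist_norm)
  then show ?thesis by (rule that)
qed

definition good_family :: "(om \<Rightarrow> real) \<Rightarrow> (om \<Rightarrow> ll \<Rightarrow> real) \<Rightarrow> bool" where
  "good_family t G \<longleftrightarrow> (\<forall>a. initial_chart a (G a)) \<and>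
    (\<forall>a b. a \<le> b \<longrightarrow> smooth_rel (upto_blk a) (G a) (G b)) \<and>
    (\<forall>x. G (blk x) x = off x) \<and>
    (\<forall>a n. a \<noteq> om_zero \<longrightarrow> G a (cofinal_seq a n) = decay (t a) n)"

lemma good_familyD:
  assumes "good_family t G"
  shows "initial_chart a (G a)" "a \<le> b \<Longrightarrow> smooth_rel (upto_blk a) (G a) (G b)"
    "G (blk x) x = off x" "a \<noteq> om_zero \<Longrightarrow> G a (cofinal_seq a n) = decay (t a) n"
    "blk x \<le> a \<Longrightarrow> blk y \<le> a \<Longrightarrow> G a x < G a y \<longleftrightarrow> x < y"
    "a \<noteq> om_zero \<Longrightarrow> G a (corner a) = 0"
proof -
  show 1: "initial_chart a (G a)" "a \<le> b \<Longrightarrow> smooth_rel (upto_blk a) (G a) (G b)"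
    "G (blk x) x = off x" "a \<noteq> om_zero \<Longrightarrow> G a (cofinal_seq a n) = decay (t a) n" for x
    using assms unfolding good_family_def by simp_all
  show "blk x \<le> a \<Longrightarrow> blk y \<le> a \<Longrightarrow> G a x < G a y \<longleftrightarrow> x < y"
    using 1(1) unfolding initial_chart_def by (metis mem_Collect_eq strict_mono_on_less)
  show "G a (corner a) = 0" if "a \<noteq> om_zero"
    using 1(3)[of "corner a"] corner[OF that] by simp
qed

lemma ex_good_family: "\<exists>G. good_family t G"
proof (rule chart_family[of t])
  fix G assume "\<And>a. initial_chart a (G a)" "\<And>a b. a \<le> b \<Longrightarrow> smooth_rel (upto_blk a) (G a) (G b)"
    "\<And>a x. blk x = a \<Longrightarrow> G a x = off x" "\<And>a n. a \<noteq> om_zero \<Longrightarrow> G a (cofinal_seq a n) = decay (t a) n"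
  then show ?thesis unfolding good_family_def by (intro exI[of _ G]) simp
qed

text \<open>The right side is taken one index later than the left. Since
  \<open>k + 2 \<le> 2 * (k + 1)\<close>, this shift costs only the factor
  \<open>2 powr - d\<close>, which the vanishing power with exponent \<open>d - e\<close>
  absorbs.\<close>

lemma powr_dominated:
  fixes d e K :: real
  assumes "0 < d" "d < e"
  shows "\<forall>\<^sub>F k::nat in sequentially. K * real (Suc k) powr - e < real (Suc (Suc k)) powr - d"
proof -
  have "(\<lambda>k. real (Suc k) powr (d - e)) \<longlonglongrightarrow> 0"
    by (rule tendsto_neg_powr) (use assms in simp, rule filterlim_compose[OF filterlim_real_sequentially filterlim_Suc])
  then have "(\<lambda>k. K * real (Suc k) powr (d - e)) \<longlonglongrightarrow> 0" by (rule tendsto_mult_right_zero)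
  then have "\<forall>\<^sub>F k in sequentially. K * real (Suc k) powr (d - e) < 2 powr - d"
    by (rule order_tendstoD) simp
  then show ?thesis
  proof eventually_elim
    case (elim k)
    have "K * real (Suc k) powr - e = (K * real (Suc k) powr (d - e)) * real (Suc k) powr - d"
      by (simp add: powr_add[symmetric])
    also have "\<dots> < 2 powr - d * real (Suc k) powr - d" using elim by (intro mult_strict_right_mono) auto
    also have "\<dots> = (2 * real (Suc k)) powr - d" by (rule powr_mult[symmetric])
    also have "\<dots> \<le> real (Suc (Suc k)) powr - d" using assms(1) by (intro powr_mono2') auto
    finally show ?case .
  qed
qed

text \<open>A linear bound along any sequence tending to the corner of block \<open>s\<close> compares the exponents there,
  because between consecutive members of the cofinal sequence the chart values are known up to a bounded factor.\<close>
lemma exponent_le: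
  assumes G: "good_family t G" and H: "good_family t' H" and s: "s \<noteq> om_zero"
    and x: "x \<longlonglongrightarrow> corner s" "\<And>n. x n < corner s"
    and bound: "\<forall>\<^sub>F n in sequentially. \<bar>H s (x n)\<bar> \<le> K * \<bar>G s (x n)\<bar>"
  shows "t s \<le> t' s"
proof (rule ccontr)
  assume "\<not> t s \<le> t' s"
  then have "exp (t' s) < exp (t s)" by simp
  from powr_dominated[OF exp_gt_zero this, of K]
  obtain N where N: "\<And>k. k \<ge> N \<Longrightarrow> K * real (Suc k) powr - exp (t s) < real (Suc (Suc k)) powr - exp (t' s)"
    unfolding eventually_sequentially by blast
  let ?p = "cofinal_seq s"
  have p: "strict_mono ?p" "\<And>n. blk (?p n) < s" using cofinal_seq[OF s] by auto
  have "?p N < corner s" using p(2) less_corner_iff[OF s] by blast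
  then have "\<forall>\<^sub>F n in sequentially. ?p N < x n" by (rule order_tendstoD(1)[OF x(1)])
  from eventually_happens'[OF sequentially_bot eventually_conj[OF this bound]] obtain n where
    n: "?p N < x n" "\<bar>H s (x n)\<bar> \<le> K * \<bar>G s (x n)\<bar>" by blast
  have xs: "blk (x n) < s" using x(2) less_corner_iff[OF s] by blast
  then obtain j where "x n < ?p j" using cofinal_seq(3)[OF s] by blast
  \<comment> \<open>This catches \<open>x n\<close> between consecutive members \<open>?p k\<close>
    and \<open>?p m\<close> of the cofinal sequence, where \<open>m = Suc k\<close>.\<close>
  define m where "m = (LEAST j. x n < ?p j)"
  have m: "x n < ?p m" unfolding m_def by (rule LeastI) fact
  have "N < m"
  proof (rule ccontr)
    assume "\<not> N < m"
    then have "?p m \<le> ?p N" using p(1) by (simp add: strict_mono_less_eq)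
    then show False using m n(1) by simp
  qed
  then obtain k where k: "m = Suc k" "k \<ge> N" by (cases m) auto
  have pk: "?p k \<le> x n" using not_less_Least[of k "\<lambda>j. x n < ?p j"] k(1) unfolding m_def by (simp add: not_less)
  have blks: "blk (x n) \<le> s" "blk (?p k) \<le> s" "blk (?p m) \<le> s" "blk (corner s) \<le> s"
    using xs p(2) corner(1)[OF s] by (simp_all add: less_imp_le)
  \<comment> \<open>Chart values are negative, so absolute values fall towards the corner:
    \<open>?p m\<close> bounds that of \<open>H\<close> from below and \<open>?p k\<close> bounds
    that of \<open>G\<close> from above.\<close>
  have "H s (x n) < H s (?p m)" using good_familyD(5)[OF H blks(1,3)] m by simp
  then have 1: "real (Suc (Suc k)) powr - exp (t' s) < \<bar>H s (x n)\<bar>"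
    using good_familyD(4)[OF H s] k(1) by (simp add: decay_def)
  have "G s (?p k) \<le> G s (x n)" using good_familyD(5)[OF G blks(1,2)] pk by (simp add: not_less[symmetric])
  moreover have "G s (x n) < 0"
    using good_familyD(5)[OF G blks(1,4)] x(2)[of n] good_familyD(6)[OF G s] by simp
  ultimately have 2: "\<bar>G s (x n)\<bar> \<le> real (Suc k) powr - exp (t s)"
    using good_familyD(4)[OF G s] by (simp add: decay_def)
  have "0 < \<bar>H s (x n)\<bar>" using 1 by (smt (verit) powr_ge_zero)
  then have "K > 0" using n(2) by (smt (verit) mult_nonpos_nonneg)
  then have "K * \<bar>G s (x n)\<bar> \<le> K * real (Suc k) powr - exp (t s)" using 2 by simp
  then show False using N[OF k(2)] 1 n(2) by linarith
qed


section \<open>Structures on the ray and on its square\<close>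

definition ray_structure :: "enat \<Rightarrow> (om \<Rightarrow> ll \<Rightarrow> real) \<Rightarrow> (lpt set \<times> (lpt \<Rightarrow> real)) set" where
  "ray_structure r G = max_atlas r Lplus (ray_atlas G)"

definition plane_structure :: "enat \<Rightarrow> (om \<Rightarrow> ll \<Rightarrow> real) \<Rightarrow> ((lpt \<times> lpt) set \<times> (lpt \<times> lpt \<Rightarrow> real \<times> real)) set" where
  "plane_structure r G = product_structure r Lplus (ray_structure r G) Lplus (ray_structure r G)"

lemma diff_structure_ray:
  assumes "good_family t G"
  shows "diff_structure r Lplus (ray_structure r G)" "ray_atlas G \<subseteq> ray_structure r G"
  using diff_structure_max_atlas atlas_subset_max atlas_ray_atlas[of G r] good_familyD(1,2)[OF assms]
  unfolding ray_structure_def by blast+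

lemma diff_structure_plane:
  assumes "good_family t G"
  shows "diff_structure r Lplus2 (plane_structure r G)"
    "prod_charts (ray_structure r G) (ray_structure r G) \<subseteq> plane_structure r G"
  using diff_structure_max_atlas atlas_subset_max
    atlas_prod[OF diff_structure_atlas[OF diff_structure_ray(1)[OF assms]]
      diff_structure_atlas[OF diff_structure_ray(1)[OF assms]], of r]
  unfolding plane_structure_def product_structure_def Lplus2_def by blast+

lemma plane_chart:
  assumes "good_family t G"
  shows "(toL ` upto_blk a \<times> toL ` upto_blk a, \<lambda>(p, q). ((G a \<circ> fromL) p, (G a \<circ> fromL) q)) \<in> plane_structure r G"
proof -
  have "(toL ` upto_blk a, G a \<circ> fromL) \<in> ray_structure r G"
    using diff_structure_ray(2)[OF assms] unfolding ray_atlas_def by blast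
  then have "(toL ` upto_blk a \<times> toL ` upto_blk a, \<lambda>(p, q). ((G a \<circ> fromL) p, (G a \<circ> fromL) q))
      \<in> prod_charts (ray_structure r G) (ray_structure r G)"
    unfolding prod_charts_def by blast
  then show ?thesis using diff_structure_plane(2)[OF assms] by blast
qed

abbreviation (input) toL2 :: "ll \<times> ll \<Rightarrow> lpt \<times> lpt" where "toL2 \<equiv> map_prod toL toL"
abbreviation (input) fromL2 :: "lpt \<times> lpt \<Rightarrow> ll \<times> ll" where "fromL2 \<equiv> map_prod fromL fromL"

lemma homeomorphic_maps_toL2: "homeomorphic_maps euclidean Lplus2 toL2 fromL2"
proof -
  have "homeomorphic_maps (prod_topology euclidean euclidean) Lplus2 toL2 fromL2"
    unfolding Lplus2_def map_prod_def homeomorphic_maps_prod using homeomorphic_maps_toL by blast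
  then show ?thesis by simp
qed

lemma toL2_facts: "fromL2 (toL2 z) = z" "p \<in> topspace Lplus2 \<Longrightarrow> toL2 (fromL2 p) = p" "toL2 z \<in> topspace Lplus2"
  using homeomorphic_maps_toL2 unfolding homeomorphic_maps_def continuous_map_def
  by (cases z, simp_all add: Pi_iff)+

lemma continuous_on_conj:
  assumes "continuous_map Lplus2 Lplus2 f"
  shows "continuous_on UNIV (fromL2 \<circ> f \<circ> toL2)"
proof -
  have "continuous_map euclidean euclidean (fromL2 \<circ> f \<circ> toL2)"
    using homeomorphic_maps_toL2 assms unfolding homeomorphic_maps_def
    by (intro continuous_map_compose[where X' = Lplus2]) auto
  then show ?thesis by simp
qed

text \<open>One chart on each side contains the base point and its image, respectively, so the
  coordinate expression of \<open>f\<close> is differentiable at the base point because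
  \<open>r \<ge> 1\<close>. Each of its components then obeys a linear bound near that
  point.\<close>

lemma smooth_map_local_bound:
  assumes r: "1 \<le> r" and G: "good_family t G" and H: "good_family t' H"
    and f: "smooth_map r Lplus2 (plane_structure r G) Lplus2 (plane_structure r H) f"
  defines "h \<equiv> fromL2 \<circ> f \<circ> toL2"
  assumes xy: "blk x0 \<le> a" "blk y0 \<le> a" "blk (fst (h (x0, y0))) \<le> a" "blk (snd (h (x0, y0))) \<le> a"
    and \<pi>: "\<pi> = fst \<or> \<pi> = snd"
  obtains K Z where "open Z" "(G a x0, G a y0) \<in> Z"
    "\<And>x y. blk x \<le> a \<Longrightarrow> blk y \<le> a \<Longrightarrow> blk (fst (h (x, y))) \<le> a \<Longrightarrow> blk (snd (h (x, y))) \<le> a \<Longrightarrow>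
      (G a x, G a y) \<in> Z \<Longrightarrow>
      \<bar>H a (\<pi> (h (x, y))) - H a (\<pi> (h (x0, y0)))\<bar> \<le> K * norm ((G a x, G a y) - (G a x0, G a y0))"
proof -
  let ?U = "toL ` upto_blk a \<times> toL ` upto_blk a"
  let ?P = "\<lambda>(p, q). ((G a \<circ> fromL) p, (G a \<circ> fromL) q)" and ?Q = "\<lambda>(p, q). ((H a \<circ> fromL) p, (H a \<circ> fromL) q)"
  let ?F = "?Q \<circ> f \<circ> inv_into ?U ?P"
  have fc: "continuous_map Lplus2 Lplus2 f" using f unfolding smooth_map_def by blast
  have "Cr r (?P ` (?U \<inter> f -` ?U)) ?F"
    using f plane_chart[OF G, of a r] plane_chart[OF H, of a r] unfolding smooth_map_def by blast
  then have C: "Ck (Suc 0) (?P ` (?U \<inter> f -` ?U)) ?F"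
    using r unfolding Cr_def by (metis One_nat_def one_enat_def)
  have inj: "inj_on ?P ?U"
    using initial_chart_inj[OF good_familyD(1)[OF G, of a]] by (auto simp: inj_on_def)
  have f_eq: "f (toL x, toL y) = toL2 (h (x, y))" for x y
    using toL2_facts(2)[of "f (toL2 (x, y))"] toL2_facts(3)[of "(x, y)"] fc
    unfolding h_def continuous_map_def by (auto simp: Pi_iff)
  have in_U: "(toL x, toL y) \<in> ?U \<inter> f -` ?U"
    if "blk x \<le> a" "blk y \<le> a" "blk (fst (h (x, y))) \<le> a" "blk (snd (h (x, y))) \<le> a" for x y
    using that f_eq[of x y] by (cases "h (x, y)") auto
  have F_eq: "?F (G a x, G a y) = (H a (fst (h (x, y))), H a (snd (h (x, y))))"
    if "blk x \<le> a" "blk y \<le> a" for x y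
  proof -
    have "(toL x, toL y) \<in> ?U" using that by blast
    then have "inv_into ?U ?P (?P (toL x, toL y)) = (toL x, toL y)" by (rule inv_into_f_f[OF inj])
    then show ?thesis using f_eq[of x y] by (cases "h (x, y)") simp
  qed
  have "?P (toL x0, toL y0) \<in> ?P ` (?U \<inter> f -` ?U)" using in_U[OF xy] by (rule imageI)
  moreover have "\<forall>z \<in> ?P ` (?U \<inter> f -` ?U). ?F differentiable (at z)" using C unfolding Ck.simps by (rule conjunct1)
  ultimately have "?F differentiable (at (?P (toL x0, toL y0)))" by (rule bspec[rotated])
  then have "?F differentiable (at (G a x0, G a y0))" by simp
  then obtain K where K: "\<forall>\<^sub>F w in nhds (G a x0, G a y0). norm (?F w - ?F (G a x0, G a y0)) \<le> K * norm (w - (G a x0, G a y0))"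
    by (rule differentiable_imp_pointwise_Lipschitz)
  then obtain Z where Z: "open Z" "(G a x0, G a y0) \<in> Z"
    "\<And>w. w \<in> Z \<Longrightarrow> norm (?F w - ?F (G a x0, G a y0)) \<le> K * norm (w - (G a x0, G a y0))"
    unfolding eventually_nhds by blast
  show ?thesis
  proof (rule that[OF Z(1,2)])
    fix x y assume xy': "blk x \<le> a" "blk y \<le> a" and z: "(G a x, G a y) \<in> Z"
    have "\<bar>H a (\<pi> (h (x, y))) - H a (\<pi> (h (x0, y0)))\<bar> \<le> norm (?F (G a x, G a y) - ?F (G a x0, G a y0))"
      unfolding F_eq[OF xy'] F_eq[OF xy(1,2)] using \<pi>
      by (auto simp: norm_fst_le norm_snd_le real_norm_def[symmetric] simp del: real_norm_def
          intro: order_trans[OF _ norm_fst_le] order_trans[OF _ norm_snd_le])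
    also have "\<dots> \<le> K * norm ((G a x, G a y) - (G a x0, G a y0))" by (rule Z(3)[OF z])
    finally show "\<bar>H a (\<pi> (h (x, y))) - H a (\<pi> (h (x0, y0)))\<bar> \<le> K * norm ((G a x, G a y) - (G a x0, G a y0))" .
  qed
qed

text \<open>With \<open>y\<close> fixed, the source point moves only in its first coordinate, from
  \<open>corner s\<close> to \<open>corner (c n)\<close>, and coordinate \<open>\<pi>\<close> of the
  image makes the same move. Both charts at \<open>s\<close> vanish at \<open>corner s\<close>, so
  the local bound becomes the linear bound that \<open>exponent_le\<close> requires.\<close>

lemma smooth_map_exponent_le:
  assumes r: "1 \<le> r" and G: "good_family t G" and H: "good_family t' H"
    and f: "smooth_map r Lplus2 (plane_structure r G) Lplus2 (plane_structure r H) f"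
  defines "h \<equiv> fromL2 \<circ> f \<circ> toL2"
  assumes kh: "\<And>z. k (h z) = z"
    and inv: "\<And>n. invariant_index h (c n)" "\<And>n. invariant_index k (c n)" "invariant_index h s" "invariant_index k s"
    and c: "strict_mono (c :: nat \<Rightarrow> om)" and s: "\<And>n. c n < s" "\<And>x. x < s \<Longrightarrow> \<exists>n. x < c n"
  shows "t s \<le> t' s"
proof -
  have nz: "c n \<noteq> om_zero" for n using inv(1) unfolding invariant_index_def by blast
  have sz: "s \<noteq> om_zero" using inv(3) unfolding invariant_index_def by blast
  have "continuous_on UNIV h"
    unfolding h_def using f by (intro continuous_on_conj) (simp add: smooth_map_def)
  from boundary_coordinate[OF this kh inv c s]
  obtain y \<pi> where y: "blk y < s" and \<pi>: "\<pi> = fst \<or> \<pi> = snd"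
    and max_s: "max (fst (h (corner s, y))) (snd (h (corner s, y))) = corner s" and \<pi>_s: "\<pi> (h (corner s, y)) = corner s"
    and ev: "\<forall>\<^sub>F n in sequentially. max (fst (h (corner (c n), y))) (snd (h (corner (c n), y))) = corner (c n)
      \<and> \<pi> (h (corner (c n), y)) = corner (c n)" by blast
  have blk_le: "blk (fst w) \<le> blk x \<and> blk (snd w) \<le> blk x" if "max (fst w) (snd w) = x" for w x
    using that blk_mono by (metis max.cobounded1 max.cobounded2)
  have cs: "blk (corner s) = s" "blk (corner (c n)) = c n" for n using corner sz nz by auto
  have 0: "blk (fst (h (corner s, y))) \<le> s" "blk (snd (h (corner s, y))) \<le> s"
    using blk_le[OF max_s] cs by auto
  \<comment> \<open>The charts at \<open>s\<close> suffice: \<open>y\<close> lies below block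
    \<open>s\<close>, and the image, a boundary point, has both coordinates at most
    \<open>corner s\<close>.\<close>
  obtain K Z where Z: "open Z" "(G s (corner s), G s y) \<in> Z"
    "\<And>u v. blk u \<le> s \<Longrightarrow> blk v \<le> s \<Longrightarrow> blk (fst (h (u, v))) \<le> s \<Longrightarrow> blk (snd (h (u, v))) \<le> s \<Longrightarrow>
      (G s u, G s v) \<in> Z \<Longrightarrow>
      \<bar>H s (\<pi> (h (u, v))) - H s (\<pi> (h (corner s, y)))\<bar> \<le> K * norm ((G s u, G s v) - (G s (corner s), G s y))"
    using smooth_map_local_bound[OF r G H f _ _ _ _ \<pi>, of "corner s" s y, folded h_def] 0 cs y by (metis less_imp_le order_refl)
  have lim: "(\<lambda>n. corner (c n)) \<longlonglongrightarrow> corner s" by (rule corner_tendsto[OF nz c s])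
  have Glim: "(\<lambda>n. G s (corner (c n))) \<longlonglongrightarrow> G s (corner s)"
  proof (rule topological_tendstoI)
    fix S assume S: "open S" "G s (corner s) \<in> S"
    have "open (upto_blk s \<inter> G s -` S)" by (rule initial_chart_continuous[OF good_familyD(1)[OF G] S(1)])
    then have "\<forall>\<^sub>F n in sequentially. corner (c n) \<in> upto_blk s \<inter> G s -` S"
      by (rule topological_tendstoD[OF lim]) (use S(2) cs in simp)
    then show "\<forall>\<^sub>F n in sequentially. G s (corner (c n)) \<in> S" by (rule eventually_mono) simp
  qed
  have "(\<lambda>n. (G s (corner (c n)), G s y)) \<longlonglongrightarrow> (G s (corner s), G s y)"
    by (intro tendsto_Pair Glim tendsto_const)
  from topological_tendstoD[OF this Z(1,2)] ev
  have "\<forall>\<^sub>F n in sequentially. \<bar>H s (corner (c n))\<bar> \<le> K * \<bar>G s (corner (c n))\<bar>"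
  proof eventually_elim
    case (elim n)
    have le: "blk (fst (h (corner (c n), y))) \<le> s" "blk (snd (h (corner (c n), y))) \<le> s" "c n \<le> s"
      using blk_le[OF conjunct1[OF elim(2)]] cs s(1)[of n] by auto
    have "\<bar>H s (corner (c n)) - H s (corner s)\<bar> \<le> K * norm ((G s (corner (c n)), G s y) - (G s (corner s), G s y))"
      using Z(3)[OF _ less_imp_le[OF y] le(1,2) elim(1)] le(3) cs elim(2) \<pi>_s by simp
    then show ?case using good_familyD(6)[OF G sz] good_familyD(6)[OF H sz] by simp
  qed
  then show ?thesis
    by (rule exponent_le[OF G H sz lim corner_less_corner[OF s(1) nz]])
qed

text \<open>The inequality is applied to \<open>f\<close> and to its inverse along the same indices.
  The common index \<open>s\<close> cannot be prescribed, only forced beyond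
  \<open>b\<close>.\<close>

lemma diffeomorphic_exponents:
  assumes r: "1 \<le> r" and G: "good_family t G" and H: "good_family t' H"
    and diff: "diffeomorphic r Lplus2 (plane_structure r G) Lplus2 (plane_structure r H)"
  shows "\<exists>s>b. t s = t' s"
proof -
  obtain f g where f: "smooth_map r Lplus2 (plane_structure r G) Lplus2 (plane_structure r H) f"
    and g: "smooth_map r Lplus2 (plane_structure r H) Lplus2 (plane_structure r G) g"
    and gf: "\<And>x. x \<in> topspace Lplus2 \<Longrightarrow> g (f x) = x" and fg: "\<And>y. y \<in> topspace Lplus2 \<Longrightarrow> f (g y) = y"
    using diff unfolding diffeomorphic_def by blast
  have cont: "continuous_map Lplus2 Lplus2 f" "continuous_map Lplus2 Lplus2 g"
    using f g unfolding smooth_map_def by auto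
  then have mem: "f (toL2 z) \<in> topspace Lplus2" "g (toL2 z) \<in> topspace Lplus2" for z
    using toL2_facts(3)[of z] unfolding continuous_map_def by (auto simp: Pi_iff)
  let ?h = "fromL2 \<circ> f \<circ> toL2" and ?k = "fromL2 \<circ> g \<circ> toL2"
  have kh: "?k (?h z) = z" and hk: "?h (?k z) = z" for z
    using toL2_facts(2)[OF mem(1)[of z]] toL2_facts(2)[OF mem(2)[of z]] gf fg toL2_facts(1,3)[of z] by simp_all
  obtain c :: "nat \<Rightarrow> om" and s where c: "strict_mono c" "b < s" "\<And>n. c n < s" "\<And>x. x < s \<Longrightarrow> \<exists>n. x < c n"
    "\<And>n. invariant_index ?h (c n) \<and> invariant_index ?k (c n)" "invariant_index ?h s \<and> invariant_index ?k s"
    using ex_invariant_sequence[OF continuous_on_conj[OF cont(1)] continuous_on_conj[OF cont(2)]] by metis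
  have "t s \<le> t' s"
    by (rule smooth_map_exponent_le[OF r G H f kh _ _ _ _ c(1,3,4)]) (use c(5,6) in blast)+
  moreover have "t' s \<le> t s"
    by (rule smooth_map_exponent_le[OF r H G g hk _ _ _ _ c(1,3,4)]) (use c(5,6) in blast)+
  ultimately show ?thesis using c(2) by auto
qed

text \<open>A set of ordinals is recorded through all its initial segments, so distinct sets have distinct codes
  at every sufficiently large index.\<close>
lemma ex_segment_code:
  obtains \<tau> :: "nat set set \<Rightarrow> om \<Rightarrow> real"
  where "\<And>A B. A \<subseteq> Field omega1 \<Longrightarrow> B \<subseteq> Field omega1 \<Longrightarrow> A \<noteq> B \<Longrightarrow> \<exists>b. \<forall>s>b. \<tau> A s \<noteq> \<tau> B s"
proof -
  obtain \<rho> :: "nat set \<Rightarrow> real" where \<rho>: "inj \<rho>"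
    using nat_sets_eqpoll_reals unfolding eqpoll_def by (metis bij_betw_imp_inj_on)
  \<comment> \<open>The countable segment below \<open>s\<close> is numbered by
    \<open>to_nat_on\<close>, the trace of \<open>A\<close> on it becomes a set of naturals, and
    \<open>\<rho>\<close> encodes that set as a real.\<close>
  define \<tau> where "\<tau> A s = \<rho> (to_nat_on {..<s} ` {a. a < s \<and> Rep_om a \<in> A})" for A s
  show ?thesis
  proof (rule that[of \<tau>])
    fix A B assume A: "A \<subseteq> Field omega1" and B: "B \<subseteq> Field omega1" and "A \<noteq> B"
    then obtain p where p: "(p \<in> A) \<noteq> (p \<in> B)" "p \<in> Field omega1" by blast
    then obtain b where b: "p = Rep_om b" using Rep_om_cases by metis
    have "\<tau> A s \<noteq> \<tau> B s" if "s > b" for s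
    proof
      assume "\<tau> A s = \<tau> B s"
      then have "to_nat_on {..<s} ` {a. a < s \<and> Rep_om a \<in> A} = to_nat_on {..<s} ` {a. a < s \<and> Rep_om a \<in> B}"
        using \<rho> unfolding \<tau>_def by (simp add: inj_eq)
      then have "{a. a < s \<and> Rep_om a \<in> A} = {a. a < s \<and> Rep_om a \<in> B}"
        using inj_on_image_eq_iff[OF inj_on_to_nat_on[OF countable_lessThan_om[of s]]] by (metis (no_types, lifting) lessThan_iff mem_Collect_eq subsetI)
      then show False using p(1) b that by blast
    qed
    then show "\<exists>b. \<forall>s>b. \<tau> A s \<noteq> \<tau> B s" by blast
  qed
qed

theorem theorem2p2:
  fixes r :: enat
  assumes "r \<ge> 1"
  shows "\<exists>S :: ((lpt \<times> lpt) set \<times> (lpt \<times> lpt \<Rightarrow> real \<times> real)) set set.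
     (\<exists>h. bij_betw h (Pow (Field omega1)) S) \<and>
     (\<forall>F\<in>S. diff_structure r Lplus2 F \<and>
        (\<exists>(D :: (lpt set \<times> (lpt \<Rightarrow> real)) set) (E :: (lpt set \<times> (lpt \<Rightarrow> real)) set).
           diff_structure r Lplus D \<and> diff_structure r Lplus E \<and>
           F = product_structure r Lplus D Lplus E)) \<and>
     (\<forall>F\<in>S. \<forall>G\<in>S. F \<noteq> G \<longrightarrow> \<not> diffeomorphic r Lplus2 F Lplus2 G)"
proof -
  obtain \<tau> :: "nat set set \<Rightarrow> om \<Rightarrow> real"
    where \<tau>: "\<And>A B. A \<subseteq> Field omega1 \<Longrightarrow> B \<subseteq> Field omega1 \<Longrightarrow> A \<noteq> B \<Longrightarrow> \<exists>b. \<forall>s>b. \<tau> A s \<noteq> \<tau> B s"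
    using ex_segment_code by metis
  have "\<exists>G. \<forall>A. good_family (\<tau> A) (G A)" by (intro choice allI ex_good_family)
  then obtain G where G: "\<And>A. good_family (\<tau> A) (G A)" by blast
  define \<Phi> where "\<Phi> A = plane_structure r (G A)" for A
  have nondiff: "\<not> diffeomorphic r Lplus2 (\<Phi> A) Lplus2 (\<Phi> B)"
    if AB: "A \<in> Pow (Field omega1)" "B \<in> Pow (Field omega1)" "A \<noteq> B" for A B
    using diffeomorphic_exponents[OF assms G G] \<tau>[of A B] AB unfolding \<Phi>_def by blast
  \<comment> \<open>Equal structures are diffeomorphic by the identity, so together with
    \<open>nondiff\<close> this makes \<open>\<Phi>\<close> injective on the subsets of
    \<open>Field omega1\<close>; hence the family has full size.\<close>
  have refl: "diffeomorphic r Lplus2 (\<Phi> A) Lplus2 (\<Phi> A)" for A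
    using smooth_map_id[OF diff_structure_plane(1)[OF G]] unfolding diffeomorphic_def \<Phi>_def by blast
  show ?thesis
  proof (intro exI[of _ "\<Phi> ` Pow (Field omega1)"] conjI ballI impI)
    have "inj_on \<Phi> (Pow (Field omega1))" using nondiff refl by (metis inj_onI)
    then show "\<exists>h. bij_betw h (Pow (Field omega1)) (\<Phi> ` Pow (Field omega1))"
      using inj_on_imp_bij_betw by blast
  next
    fix F assume "F \<in> \<Phi> ` Pow (Field omega1)"
    then obtain A where A: "F = \<Phi> A" by blast
    show "diff_structure r Lplus2 F" unfolding A \<Phi>_def by (rule diff_structure_plane(1)[OF G])
    show "\<exists>D E. diff_structure r Lplus (D :: (lpt set \<times> (lpt \<Rightarrow> real)) set) \<and>
        diff_structure r Lplus (E :: (lpt set \<times> (lpt \<Rightarrow> real)) set) \<and> F = product_structure r Lplus D Lplus E"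
      unfolding A \<Phi>_def plane_structure_def using diff_structure_ray(1)[OF G] by blast
  next
    fix F F' assume "F \<in> \<Phi> ` Pow (Field omega1)" "F' \<in> \<Phi> ` Pow (Field omega1)" "F \<noteq> F'"
    then show "\<not> diffeomorphic r Lplus2 F Lplus2 F'" using nondiff by blast
  qed
qed

end
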